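(* (a) Let $t\ge s\ge k\ge 2$. Then \[ st-kt+1\le mc_k(K_{s,t})\le st-\left\lceil\frac{kt}{2}\right\rceil+1. \] Moreover, if $s=k\ge 2$, or if $k\in\{2,3\}$, then $mc_k(K_{s,t})=st-kt+1$. (b) Let $t\ge k\ge 2$. Then \[ t^2-kt+1\le mc_k(K_{t,t})\le t^2-\left\lceil\left(k-\frac{1}{2}\right)t\right\rceil+1. \] Moreover, if $k\in\{2,3,4,5\}$, then $mc_k(K_{t,t})=t^2-kt+1$.
   Context: $K_{s,t}$ is the complete bipartite graph with partition classes of sizes $s$ and $t$. Paths are called disjoint if they are internally vertex-disjoint. An edge-coloured path is monochromatic if all its edges have the same colour. For a $k$-connected graph $G$, an edge-colouring is monochromatic $k$-connected if any two vertices are connected by $k$ disjoint monochromatic paths; $mc_k(G)$ is the maximum number of colours in a monochromatic $k$-connected colouring of $G$. *)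

theory Defs
  imports Complex_Main
begin

text \<open>Graphs are given by a vertex set V and an edge set E of 2-element vertex sets.
An edge-colouring is a function from edges to colours (natural numbers).\<close>

definition is_path :: "'a set set \<Rightarrow> 'a list \<Rightarrow> 'a \<Rightarrow> 'a \<Rightarrow> bool" where
  "is_path E P u v \<longleftrightarrow> 2 \<le> length P \<and> hd P = u \<and> last P = v \<and> distinct P \<and>
     (\<forall>i. Suc i < length P \<longrightarrow> {P ! i, P ! Suc i} \<in> E)"

definition monochromatic :: "('a set \<Rightarrow> 'c) \<Rightarrow> 'a list \<Rightarrow> bool" where
  "monochromatic c P \<longleftrightarrow> (\<exists>col. \<forall>i. Suc i < length P \<longrightarrow> c {P ! i, P ! Suc i} = col)"

definition interior :: "'a list \<Rightarrow> 'a set" where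
  "interior P = set P - {hd P, last P}"

definition mono_k_connected :: "'a set \<Rightarrow> 'a set set \<Rightarrow> nat \<Rightarrow> ('a set \<Rightarrow> 'c) \<Rightarrow> bool" where
  "mono_k_connected V E k c \<longleftrightarrow>
     (\<forall>u\<in>V. \<forall>v\<in>V. u \<noteq> v \<longrightarrow>
        (\<exists>Ps. length Ps = k \<and> distinct Ps \<and>
              (\<forall>P\<in>set Ps. is_path E P u v \<and> monochromatic c P) \<and>
              (\<forall>i<k. \<forall>j<k. i \<noteq> j \<longrightarrow> interior (Ps ! i) \<inter> interior (Ps ! j) = {})))"

definition mc :: "'a set \<Rightarrow> 'a set set \<Rightarrow> nat \<Rightarrow> nat" where
  "mc V E k = Max {card (c ` E) | c :: 'a set \<Rightarrow> nat. mono_k_connected V E k c}"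

definition Kbip_V :: "nat \<Rightarrow> nat \<Rightarrow> (nat + nat) set" where
  "Kbip_V s t = Inl ` {..<s} \<union> Inr ` {..<t}"

definition Kbip_E :: "nat \<Rightarrow> nat \<Rightarrow> (nat + nat) set set" where
  "Kbip_E s t = {{Inl i, Inr j} | i j. i < s \<and> j < t}"

definition mcK :: "nat \<Rightarrow> nat \<Rightarrow> nat \<Rightarrow> nat" where
  "mcK s t k = mc (Kbip_V s t) (Kbip_E s t) k"

end

theory Submission
  imports Defs
begin

text \<open>Lower bounds: colour a \<open>k\<close>-connected spanning subgraph with \<open>k t\<close> edges with one colour and give
  every other edge a colour of its own. The subgraph is a bipartite circulant with some right vertices
  duplicated, and the disjoint paths in it are written down explicitly.

  Upper bounds: refine the colour classes to their connected components. If \<open>H\<close> ranges over the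
  components, the number of colours is at most \<open>s t - W\<close> with \<open>W = \<Sum>\<^sub>H (|H| - 1)\<close>. Any two vertices
  satisfy \<open>\<Sum>\<^sub>H min (deg\<^sub>H u) (deg\<^sub>H v) \<ge> k\<close>. Summing this over all pairs on the side of size \<open>t\<close> gives
  \<open>W \<ge> k t - N\<close>, where \<open>N\<close> is the number of classes covering that side. For \<open>N \<le> 1\<close> this is the exact
  bound. Otherwise, for \<open>k \<le> 3\<close>, two covering classes produce enough slack at a single vertex. For
  \<open>s = t\<close> one also has \<open>W \<ge> (N + N') (t - 1)\<close>, with \<open>N'\<close> the analogue for the other side, which for
  \<open>k \<le> 5\<close> leaves only the case of equality with \<open>N = 2\<close>: there the graph consists of two regular
  classes of total degree \<open>k\<close> and single edges, one of the two is a Hamiltonian cycle, and this leaves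
  no room for further disjoint paths.\<close>

section \<open>Paths, linkages and connected edge sets\<close>

text \<open>A class covering the side of size \<open>t\<close> is the obstacle: it is the only kind
  of class that may fall short of its share, by one. But such a class has at least \<open>t\<close>
  edges, so \<open>N (t - 1) \<le> W\<close>, and together with \<open>W \<ge> k t - N\<close> this
  yields the half bound.

  The constants arise as follows. Two covering classes give \<open>W \<ge> k (t - 1) + 2\<close>,
  which is at least \<open>k t - 1\<close> exactly when \<open>k \<le> 3\<close>. For
  \<open>s = t\<close> and \<open>k < t\<close>, having \<open>N\<close> and \<open>N'\<close> both
  at least 3 would give \<open>6 (t - 1) \<le> k t - 2\<close>, impossible for
  \<open>k \<le> 5\<close>; and if \<open>N = 2\<close>, two degrees that are at least 2 and add up
  to at most 5 cannot both exceed 2, which is where the Hamiltonian cycle comes from.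

  The case \<open>s = k\<close> is of a different kind: \<open>k\<close> disjoint paths leaving a
  vertex on the side of size \<open>t\<close> use up the whole opposite side, and this forces a
  single class.

  Passing to components loses no monochromatic path. Connectedness is what excludes stars, bounds
  the vertices of a class by its edges plus one, and recognises the Hamiltonian cycle.\<close>

definition conn_edges :: "'a set set \<Rightarrow> bool" where
  "conn_edges H \<longleftrightarrow> (\<forall>F\<subseteq>H. F \<noteq> {} \<longrightarrow> F \<noteq> H \<longrightarrow> (\<exists>e\<in>H - F. \<exists>f\<in>F. e \<inter> f \<noteq> {}))"

text \<open>As in \<^const>\<open>mono_k_connected\<close>, with colour classes in place of a colouring.\<close>

definition linkage :: "'a set set set \<Rightarrow> nat \<Rightarrow> 'a \<Rightarrow> 'a \<Rightarrow> 'a list list \<Rightarrow> bool" where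
  "linkage C k u v Ps \<longleftrightarrow> length Ps = k \<and> distinct Ps \<and>
     (\<forall>P\<in>set Ps. \<exists>H\<in>C. is_path H P u v) \<and>
     (\<forall>i<k. \<forall>j<k. i \<noteq> j \<longrightarrow> interior (Ps ! i) \<inter> interior (Ps ! j) = {})"

definition deg :: "'a set set \<Rightarrow> 'a \<Rightarrow> nat" where
  "deg H v = card {e \<in> H. v \<in> e}"

lemma is_path_rev:
  assumes "is_path H P u v"
  shows "is_path H (rev P) v u"
proof -
  have ne: "P \<noteq> []" using assms unfolding is_path_def by auto
  have "{rev P ! i, rev P ! Suc i} \<in> H" if i: "Suc i < length P" for i
  proof -
    define j where "j = length P - Suc (Suc i)"
    have j: "Suc j < length P" "length P - Suc i = Suc j" using i unfolding j_def by auto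
    have "rev P ! i = P ! Suc j" "rev P ! Suc i = P ! j"
      using i j by (simp_all add: rev_nth j_def)
    moreover have "{P ! j, P ! Suc j} \<in> H" using assms j unfolding is_path_def by auto
    ultimately show ?thesis by (simp add: insert_commute)
  qed
  then show ?thesis
    using assms ne unfolding is_path_def by (simp add: hd_rev last_rev)
qed

lemma interior_rev: "interior (rev P) = interior P"
  by (cases "P = []") (auto simp: interior_def hd_rev last_rev)

lemma linkage_rev:
  assumes "linkage C k u v Ps"
  shows "linkage C k v u (map rev Ps)"
proof -
  have "\<exists>H\<in>C. is_path H (rev P) v u" if "P \<in> set Ps" for P
    using assms that is_path_rev unfolding linkage_def by metis
  then show ?thesis
    using assms unfolding linkage_def by (auto simp: distinct_map interior_rev)
qed

text \<open>The second vertex labels a path: it is either \<open>v\<close>, and the path is a single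
  edge, or an interior vertex, which no other path of a linkage contains.\<close>

lemma is_path_second:
  assumes "is_path H P u v"
  shows "{u, P ! 1} \<in> H" "P ! 1 \<in> set P" "P ! 1 \<noteq> u" "P ! 1 = v \<Longrightarrow> P = [u, v]"
    "P ! 1 \<noteq> v \<Longrightarrow> P ! 1 \<in> interior P"
proof -
  obtain a b Q where P: "P = a # b # Q"
    using assms unfolding is_path_def by (cases P; cases "tl P") auto
  have a: "a = u" "{a, b} \<in> H" "distinct P" "last P = v"
    using assms P unfolding is_path_def by (auto dest: spec[of _ 0])
  show "{u, P ! 1} \<in> H" "P ! 1 \<in> set P" "P ! 1 \<noteq> u" using a P by auto
  show "P = [u, v]" if "P ! 1 = v"
    using that a P by (cases "Q = []") (auto simp: last_ConsR split: if_splits)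
  show "P ! 1 \<in> interior P" if "P ! 1 \<noteq> v"
    using that a P by (auto simp: interior_def)
qed

lemma is_path_ends:
  assumes "is_path H P u v"
  shows "hd P = u" "last P = v" "u \<in> set P" "v \<in> set P"
proof -
  have "P \<noteq> []" "hd P = u" "last P = v" using assms unfolding is_path_def by auto
  then show "hd P = u" "last P = v" "u \<in> set P" "v \<in> set P"
    using hd_in_set[of P] last_in_set[of P] by auto
qed

lemma is_path_inner_edges:
  assumes "is_path H P u v" "w \<in> interior P"
  obtains e f where "e \<in> H" "f \<in> H" "e \<noteq> f" "w \<in> e" "w \<in> f" "e \<subseteq> set P" "f \<subseteq> set P"
proof -
  have P: "distinct P" "2 \<le> length P" "\<And>i. Suc i < length P \<Longrightarrow> {P ! i, P ! Suc i} \<in> H"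
    using assms(1) unfolding is_path_def by auto
  have w: "w \<in> set P" "w \<noteq> hd P" "w \<noteq> last P" using assms(2) unfolding interior_def by auto
  then obtain i where i: "i < length P" "w = P ! i" by (metis in_set_conv_nth)
  have "i \<noteq> 0" using i w P(2) by (metis hd_conv_nth length_greater_0_conv)
  then obtain j where j: "i = Suc j" by (cases i) auto
  have "Suc i \<noteq> length P" using i w P(2) by (metis diff_Suc_1 last_conv_nth list.size(3) nat.distinct(1))
  then have Si: "Suc i < length P" using i by simp
  show ?thesis
  proof (rule that[of "{P ! j, P ! i}" "{P ! i, P ! Suc i}"])
    have "P ! j \<noteq> P ! Suc i" using P(1) Si j by (simp add: nth_eq_iff_index_eq)
    moreover have "P ! j \<noteq> P ! i" using P(1) i j by (simp add: nth_eq_iff_index_eq)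
    ultimately show "{P ! j, P ! i} \<noteq> {P ! i, P ! Suc i}" by (auto simp: doubleton_eq_iff)
  qed (use P(3)[of j] P(3)[of i] Si j i in auto)
qed

text \<open>A common second vertex would be a common interior vertex unless it is \<open>v\<close>.
  Then both paths are \<open>[u, v]\<close>, whose interior is empty, and it is
  \<open>distinct Ps\<close> that excludes the repetition.\<close>

lemma linkage_second_inj:
  assumes "linkage C k u v Ps"
  shows "inj_on (\<lambda>i. Ps ! i ! 1) {..<k}"
proof (rule inj_onI, rule ccontr)
  fix i j assume ij: "i \<in> {..<k}" "j \<in> {..<k}" "Ps ! i ! 1 = Ps ! j ! 1" "i \<noteq> j"
  obtain H H' where H: "is_path H (Ps ! i) u v" "is_path H' (Ps ! j) u v"
    using assms ij unfolding linkage_def by (metis lessThan_iff nth_mem)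
  show False
  proof (cases "Ps ! i ! 1 = v")
    case True
    then have "Ps ! i = Ps ! j" using is_path_second(4) H ij(3) by metis
    then show False using assms ij unfolding linkage_def by (auto simp: nth_eq_iff_index_eq)
  next
    case False
    then have "Ps ! i ! 1 \<in> interior (Ps ! i) \<inter> interior (Ps ! j)"
      using is_path_second(5)[OF H(1)] is_path_second(5)[OF H(2)] ij(3) by auto
    then show False using assms ij unfolding linkage_def by auto
  qed
qed

lemma linkage_class_le_deg:
  assumes "linkage C k u v Ps" "finite H"
  shows "card {i. i < k \<and> is_path H (Ps ! i) u v} \<le> deg H u"
proof -
  let ?I = "{i. i < k \<and> is_path H (Ps ! i) u v}"
  have "inj_on (\<lambda>i. {u, Ps ! i ! 1}) ?I"
  proof (rule inj_onI)
    fix i j assume "i \<in> ?I" "j \<in> ?I" "{u, Ps ! i ! 1} = {u, Ps ! j ! 1}"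
    then have "Ps ! i ! 1 = Ps ! j ! 1" by (auto simp: doubleton_eq_iff)
    then show "i = j" using linkage_second_inj[OF assms(1)] \<open>i \<in> ?I\<close> \<open>j \<in> ?I\<close>
      by (auto dest: inj_onD)
  qed
  moreover have "(\<lambda>i. {u, Ps ! i ! 1}) ` ?I \<subseteq> {e \<in> H. u \<in> e}"
    using is_path_second(1) by auto
  moreover have "finite {e \<in> H. u \<in> e}" using assms(2) by simp
  ultimately show ?thesis unfolding deg_def by (rule card_inj_on_le)
qed

lemma linkage_class_le_min_deg:
  assumes "linkage C k u v Ps" "finite H"
  shows "card {i. i < k \<and> is_path H (Ps ! i) u v} \<le> min (deg H u) (deg H v)"
proof -
  have len: "length Ps = k" using assms(1) unfolding linkage_def by simp
  have "{i. i < k \<and> is_path H (Ps ! i) u v} = {i. i < k \<and> is_path H (map rev Ps ! i) v u}"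
    using len is_path_rev[of H _ u v] is_path_rev[of H _ v u] by fastforce
  then show ?thesis
    using linkage_class_le_deg[OF assms] linkage_class_le_deg[OF linkage_rev[OF assms(1)] assms(2)]
    by simp
qed

text \<open>Growing a subset edge by edge: connectedness supplies an edge meeting what is already
  there, so each addition brings at most one new vertex.\<close>

lemma conn_edges_card:
  assumes "conn_edges H" "finite H" "H \<noteq> {}" "\<And>e. e \<in> H \<Longrightarrow> card e = 2"
  shows "card (\<Union>H) \<le> card H + 1"
proof -
  have fin: "finite (\<Union>F)" if "F \<subseteq> H" for F
    using that assms by (metis card.infinite finite_Union finite_subset subsetD zero_neq_numeral)
  have "\<exists>F\<subseteq>H. card F = n \<and> card (\<Union>F) \<le> card F + 1" if "1 \<le> n" "n \<le> card H" for n
    using that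
  proof (induction n rule: dec_induct)
    case base
    obtain e where "e \<in> H" using assms by auto
    then show ?case using assms(4)[of e] by (intro exI[of _ "{e}"]) auto
  next
    case (step n)
    then obtain F where F: "F \<subseteq> H" "card F = n" "card (\<Union>F) \<le> card F + 1" by auto
    have "F \<noteq> {}" "F \<noteq> H" using F step by auto
    then obtain e f where e: "e \<in> H - F" "f \<in> F" "e \<inter> f \<noteq> {}"
      using assms(1) F unfolding conn_edges_def by meson
    then obtain x where x: "x \<in> e" "x \<in> f" by auto
    have c2: "card e = 2" using e assms by auto
    then have fe: "finite e" by (metis card.infinite zero_neq_numeral)
    have "\<Union>(insert e F) \<subseteq> \<Union>F \<union> (e - {x})" using x e by auto
    then have "card (\<Union>(insert e F)) \<le> card (\<Union>F \<union> (e - {x}))"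
      using fin[OF F(1)] fe by (intro card_mono) auto
    also have "\<dots> \<le> card (\<Union>F) + card (e - {x})" by (rule card_Un_le)
    also have "card (e - {x}) = 1" using c2 x fe by simp
    finally have "card (\<Union>(insert e F)) \<le> card (\<Union>F) + 1" .
    moreover have "card (insert e F) = Suc n"
      using F e assms(2) by (metis Diff_iff card_insert_disjoint finite_subset)
    ultimately show ?case using F e by (intro exI[of _ "insert e F"]) auto
  qed
  from this[of "card H"] show ?thesis using assms
    by (metis One_nat_def Suc_leI card_gt_0_iff card_subset_eq order_refl)
qed

section \<open>Counting in partitions of a complete bipartite graph\<close>

text \<open>\<open>C\<close> abstracts the set of components of the colour classes. The hypotheses
  are symmetric in \<open>A\<close> and \<open>B\<close>, so \<open>swap\<close> transfers every
  result about \<open>B\<close> to \<open>A\<close>.\<close>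

locale mono_bipartite =
  fixes A B :: "'a set" and C :: "'a set set set" and k :: nat
  assumes finA: "finite A" and finB: "finite B" and disj: "A \<inter> B = {}"
    and k2: "2 \<le> k"
    and UnC: "\<Union>C = {{x, y} | x y. x \<in> A \<and> y \<in> B}"
    and disjC: "\<And>H H'. H \<in> C \<Longrightarrow> H' \<in> C \<Longrightarrow> H \<noteq> H' \<Longrightarrow> H \<inter> H' = {}"
    and neC: "{} \<notin> C"
    and conn: "\<And>H. H \<in> C \<Longrightarrow> conn_edges H"
    and ex_linkage: "\<And>u v. u \<in> A \<union> B \<Longrightarrow> v \<in> A \<union> B \<Longrightarrow> u \<noteq> v \<Longrightarrow> \<exists>Ps. linkage C k u v Ps"
begin

lemma swap: "mono_bipartite B A C k"
proof
  show "\<Union>C = {{x, y} | x y. x \<in> B \<and> y \<in> A}" unfolding UnC by (auto simp: insert_commute)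
  show "B \<inter> A = {}" using disj by blast
  show "\<exists>Ps. linkage C k u v Ps" if "u \<in> B \<union> A" "v \<in> B \<union> A" "u \<noteq> v" for u v
    using ex_linkage that by blast
qed (fact finA finB k2 disjC neC conn)+

text \<open>By \<open>weight_eq\<close> this is the number of edges minus the number of classes, so
  a lower bound on it is an upper bound on the number of colours.\<close>

definition weight :: int where "weight = (\<Sum>H\<in>C. int (card H) - 1)"

definition covering :: "'a set set set" where "covering = {H \<in> C. B \<subseteq> \<Union>H}"

section \<open>Degree counts and the slack of a pair of vertices\<close>

lemma edgeE:
  assumes "H \<in> C" "e \<in> H"
  obtains x y where "e = {x, y}" "x \<in> A" "y \<in> B" "x \<noteq> y"
proof -
  have "e \<in> \<Union>C" using assms by auto
  then show ?thesis using that disj unfolding UnC by blast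
qed

lemma finE: "finite (\<Union>C)"
proof -
  have "\<Union>C \<subseteq> Pow (A \<union> B)" unfolding UnC by auto
  then show ?thesis using finA finB by (meson finite_Pow_iff finite_UnI finite_subset)
qed

lemma finC: "finite C" using finE finite_UnionD by blast

lemma finH: "H \<in> C \<Longrightarrow> finite H" using finE by (meson Union_upper finite_subset)

lemma card_pos: "H \<in> C \<Longrightarrow> 1 \<le> card H"
  using finH neC by (metis One_nat_def Suc_leI card_gt_0_iff)

lemma card_edges: "card (\<Union>C) = card A * card B"
proof -
  have "\<Union>C = (\<lambda>(x, y). {x, y}) ` (A \<times> B)" unfolding UnC by auto
  moreover have "inj_on (\<lambda>(x, y). {x, y}) (A \<times> B)"
    using disj by (auto simp: inj_on_def doubleton_eq_iff)
  ultimately show ?thesis by (simp add: card_image card_cartesian_product)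
qed

lemma weight_eq: "weight = int (card A * card B) - int (card C)"
proof -
  have "card (\<Union>C) = (\<Sum>H\<in>C. card H)"
    by (rule card_Union_disjoint) (use disjC finH in \<open>auto simp: pairwise_def disjnt_def\<close>)
  then have "int (card A * card B) = (\<Sum>H\<in>C. int (card H))" using card_edges by simp
  then show ?thesis unfolding weight_def by (simp add: sum_subtractf)
qed

lemma card_eq_sum_deg:
  assumes "H \<in> C"
  shows "card H = (\<Sum>u\<in>B. deg H u)"
proof -
  have "H = (\<Union>u\<in>B. {e \<in> H. u \<in> e})" using assms by (auto elim: edgeE)
  moreover have "card (\<Union>u\<in>B. {e \<in> H. u \<in> e}) = (\<Sum>u\<in>B. card {e \<in> H. u \<in> e})"
  proof (rule card_UN_disjoint)
    show "\<forall>i\<in>B. \<forall>j\<in>B. i \<noteq> j \<longrightarrow> {e \<in> H. i \<in> e} \<inter> {e \<in> H. j \<in> e} = {}"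
    proof (intro ballI impI equals0I)
      fix i j e assume ij: "i \<in> B" "j \<in> B" "i \<noteq> j" "e \<in> {e \<in> H. i \<in> e} \<inter> {e \<in> H. j \<in> e}"
      then obtain x y where "e = {x, y}" "x \<in> A" "y \<in> B" using edgeE[OF assms, of e] by blast
      then show False using ij disj by auto
    qed
  qed (use finB finH[OF assms] in auto)
  ultimately show ?thesis unfolding deg_def by simp
qed

lemma deg_pos_iff: "H \<in> C \<Longrightarrow> 0 < deg H v \<longleftrightarrow> v \<in> \<Union>H"
  unfolding deg_def using finH by (auto simp: card_gt_0_iff)

text \<open>Each of the \<open>k\<close> paths lies in one class, and those inside \<open>H\<close>
  use different edges at \<open>u\<close> and different edges at \<open>v\<close>.\<close>

lemma sum_min_deg_ge:
  assumes "u \<in> A \<union> B" "v \<in> A \<union> B" "u \<noteq> v"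
  shows "k \<le> (\<Sum>H\<in>C. min (deg H u) (deg H v))"
proof -
  obtain Ps where Ps: "linkage C k u v Ps" using ex_linkage assms by blast
  have "{..<k} = (\<Union>H\<in>C. {i. i < k \<and> is_path H (Ps ! i) u v})"
  proof (intro equalityI subsetI)
    fix i assume "i \<in> {..<k}"
    then have "i < k" "Ps ! i \<in> set Ps" using Ps unfolding linkage_def by auto
    then show "i \<in> (\<Union>H\<in>C. {i. i < k \<and> is_path H (Ps ! i) u v})"
      using Ps unfolding linkage_def by blast
  qed auto
  then have "k = card (\<Union>H\<in>C. {i. i < k \<and> is_path H (Ps ! i) u v})" by (metis card_lessThan)
  also have "\<dots> \<le> (\<Sum>H\<in>C. card {i. i < k \<and> is_path H (Ps ! i) u v})"
    using finC by (rule card_UN_le)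
  also have "\<dots> \<le> (\<Sum>H\<in>C. min (deg H u) (deg H v))"
    by (intro sum_mono linkage_class_le_min_deg[OF Ps] finH)
  finally show ?thesis .
qed

text \<open>Every path from \<open>u\<close> to \<open>v\<close> uses its own edge at \<open>u\<close>, lying in a class that meets \<open>v\<close>;
  the slack is the number of such edges beyond the \<open>k\<close> that are needed.\<close>

definition slack :: "'a \<Rightarrow> 'a \<Rightarrow> int" where
  "slack v u = (\<Sum>H\<in>{H \<in> C. v \<in> \<Union>H}. int (deg H u)) - int k"

text \<open>The minima over the classes meeting \<open>v\<close> already sum to at least
  \<open>k\<close>, so \<open>slack v u\<close> dominates the sum of the non-negative differences,
  hence each single one.\<close>

lemma slack_ge:
  assumes "u \<in> A \<union> B" "v \<in> A \<union> B" "u \<noteq> v" "H \<in> C" "v \<in> \<Union>H"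
  shows "int (deg H u) - int (min (deg H u) (deg H v)) \<le> slack v u"
proof -
  let ?S = "{H \<in> C. v \<in> \<Union>H}"
  have fin: "finite ?S" using finC by auto
  have "(\<Sum>H\<in>C. min (deg H u) (deg H v)) = (\<Sum>H\<in>?S. min (deg H u) (deg H v))"
  proof (rule sum.mono_neutral_right)
    show "\<forall>H\<in>C - ?S. min (deg H u) (deg H v) = 0"
    proof
      fix H assume "H \<in> C - ?S"
      then have "deg H v = 0" using deg_pos_iff[of H v] by blast
      then show "min (deg H u) (deg H v) = 0" by simp
    qed
  qed (use finC in auto)
  then have "int k \<le> (\<Sum>H\<in>?S. int (min (deg H u) (deg H v)))"
    using sum_min_deg_ge[OF assms(1-3)] unfolding of_nat_sum[symmetric] of_nat_le_iff by linarith
  then have "(\<Sum>H\<in>?S. int (deg H u) - int (min (deg H u) (deg H v))) \<le> slack v u"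
    unfolding slack_def by (simp add: sum_subtractf)
  moreover have "int (deg H u) - int (min (deg H u) (deg H v))
      \<le> (\<Sum>H\<in>?S. int (deg H u) - int (min (deg H u) (deg H v)))"
    by (rule member_le_sum) (use assms fin in auto)
  ultimately show ?thesis by linarith
qed

lemma slack_nonneg:
  assumes "u \<in> A \<union> B" "v \<in> A \<union> B" "u \<noteq> v"
  shows "0 \<le> slack v u"
proof -
  have "0 < (\<Sum>H\<in>C. min (deg H u) (deg H v))" using sum_min_deg_ge[OF assms] k2 by linarith
  then have "(\<Sum>H\<in>C. min (deg H u) (deg H v)) \<noteq> 0" by (rule gr_implies_not0)
  then obtain H where "H \<in> C" "0 < min (deg H u) (deg H v)"
    by (rule sum.not_neutral_contains_not_neutral) (use neq0_conv in blast)
  then have "int (deg H u) - int (min (deg H u) (deg H v)) \<le> slack v u"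
    using slack_ge[OF assms, of H] deg_pos_iff[of H v] by simp
  then show ?thesis by linarith
qed

lemma sum_slack:
  assumes "v \<in> B"
  shows "(\<Sum>u\<in>B - {v}. slack v u)
    = (\<Sum>H\<in>{H \<in> C. v \<in> \<Union>H}. int (card H) - int (deg H v)) - int k * (int (card B) - 1)"
proof -
  have "(\<Sum>u\<in>B - {v}. \<Sum>H\<in>{H \<in> C. v \<in> \<Union>H}. int (deg H u))
      = (\<Sum>H\<in>{H \<in> C. v \<in> \<Union>H}. \<Sum>u\<in>B - {v}. int (deg H u))"
    by (rule sum.swap)
  also have "\<dots> = (\<Sum>H\<in>{H \<in> C. v \<in> \<Union>H}. int (card H) - int (deg H v))"
  proof (rule sum.cong)
    fix H assume "H \<in> {H \<in> C. v \<in> \<Union>H}"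
    then have "int (card H) = (\<Sum>u\<in>B. int (deg H u))" using card_eq_sum_deg by simp
    then show "(\<Sum>u\<in>B - {v}. int (deg H u)) = int (card H) - int (deg H v)"
      using assms finB by (simp add: sum_diff1)
  qed simp
  moreover have "int (card (B - {v})) = int (card B) - 1"
    using card.remove[OF finB assms] by simp
  ultimately show ?thesis unfolding slack_def by (simp add: sum_subtractf)
qed

text \<open>Splits \<open>card H - 1\<close> into \<open>card H - deg H v\<close>, which
  \<open>sum_slack\<close> evaluates, and \<open>deg H v - 1\<close>; the classes missing
  \<open>v\<close> contribute at least 0.\<close>

lemma weight_ge_local:
  assumes "v \<in> B"
  shows "int k * (int (card B) - 1) + (\<Sum>H\<in>{H \<in> C. v \<in> \<Union>H}. int (deg H v) - 1)
    + (\<Sum>u\<in>B - {v}. slack v u) \<le> weight"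
proof -
  have "(\<Sum>H\<in>{H \<in> C. v \<in> \<Union>H}. int (card H) - 1) \<le> weight" unfolding weight_def
  proof (rule sum_mono2)
    show "0 \<le> int (card H) - 1" if "H \<in> C - {H \<in> C. v \<in> \<Union>H}" for H
      using that card_pos[of H] by simp
  qed (use finC in auto)
  then show ?thesis unfolding sum_slack[OF assms] by (simp add: sum_subtractf)
qed

text \<open>Meant for the centre of a star, whose degree is the number of edges of the star.\<close>

lemma weight_ge_excess:
  assumes "v \<in> B" "H \<in> C" "1 \<le> deg H v"
  shows "int k * (int (card B) - 1) + int (deg H v) - 1 \<le> weight"
proof -
  let ?S = "{H \<in> C. v \<in> \<Union>H}"
  have "H \<in> ?S" using assms deg_pos_iff[of H v] by auto
  moreover have "finite ?S" using finC by auto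
  moreover have "0 \<le> int (deg H' v) - 1" if "H' \<in> ?S" for H'
  proof -
    have "0 < deg H' v" using that deg_pos_iff[of H' v] by blast
    then show ?thesis by simp
  qed
  ultimately have "int (deg H v) - 1 \<le> (\<Sum>H\<in>?S. int (deg H v) - 1)"
    by (intro member_le_sum[of H ?S "\<lambda>H. int (deg H v) - 1"]) auto
  moreover have "0 \<le> (\<Sum>u\<in>B - {v}. slack v u)"
    by (intro sum_nonneg slack_nonneg) (use assms in auto)
  ultimately show ?thesis using weight_ge_local[OF assms(1)] by linarith
qed

section \<open>Support of a class and the global bound\<close>

definition support :: "'a set set \<Rightarrow> nat" where "support H = card (B \<inter> \<Union>H)"

lemma support_le_card:
  assumes "H \<in> C" shows "support H \<le> card H"
proof -
  have "card H = (\<Sum>u\<in>B. deg H u)" by (rule card_eq_sum_deg[OF assms])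
  also have "\<dots> \<ge> (\<Sum>u\<in>B \<inter> \<Union>H. deg H u)" using finB by (intro sum_mono2) auto
  moreover have "(\<Sum>u\<in>B \<inter> \<Union>H. deg H u) \<ge> (\<Sum>u\<in>B \<inter> \<Union>H. 1)"
    using deg_pos_iff[OF assms] by (intro sum_mono) (simp add: Suc_leI)
  ultimately show ?thesis unfolding support_def by simp
qed

lemma support_pos:
  assumes "H \<in> C" shows "1 \<le> support H"
proof -
  obtain e where "e \<in> H" using neC assms by (metis all_not_in_conv)
  moreover from this obtain x y where "e = {x, y}" "y \<in> B" using edgeE[OF assms] by metis
  ultimately have "B \<inter> \<Union>H \<noteq> {}" by blast
  then show ?thesis unfolding support_def using finB by (simp add: Suc_leI card_gt_0_iff)
qed

lemma support_eq_iff: "support H = card B \<longleftrightarrow> B \<subseteq> \<Union>H"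
  unfolding support_def using finB card_subset_eq[of B "B \<inter> \<Union>H"] by (auto simp: Int_absorb2)

lemma support_le: "support H \<le> card B"
  unfolding support_def using finB by (simp add: card_mono)

text \<open>With \<open>b = card B\<close>, \<open>e = card H\<close> and
  \<open>\<tau> = support H\<close>, a covering class gives exactly 0. Otherwise
  \<open>x = b - \<tau>\<close> is at least 1, and the expression equals
  \<open>(e - 1) (x - 1) + (e - \<tau>)\<close>; its zeros are used again in the case of
  equality.\<close>

lemma class_slack_nonneg:
  assumes "H \<in> C"
  shows "0 \<le> (int (card B) - 1) * (int (card H) - 1) + (if B \<subseteq> \<Union>H then int (card B) - 1 else 0)
    - (int (support H) - 1) * int (card H)"
proof (cases "B \<subseteq> \<Union>H")
  case True
  then show ?thesis using support_eq_iff[of H] by (simp add: algebra_simps)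
next
  case False
  define x where "x = int (card B) - int (support H)"
  have x: "1 \<le> x" using False support_eq_iff[of H] support_le[of H] unfolding x_def by auto
  have "1 \<le> int (support H)" "int (support H) \<le> int (card H)"
    using support_le_card[OF assms] support_pos[OF assms] by auto
  then have "0 \<le> (int (card H) - 1) * (x - 1) + (int (card H) - int (support H))"
    using x by (intro add_nonneg_nonneg mult_nonneg_nonneg) auto
  also have "\<dots> = (int (card B) - 1) * (int (card H) - 1) - (int (support H) - 1) * int (card H)"
    unfolding x_def by (simp add: algebra_simps)
  finally show ?thesis using False by simp
qed

text \<open>Summing the local slacks over all ordered pairs in \<open>B\<close>. A class which does not cover \<open>B\<close>
  can be charged its full weight because \<open>(\<tau> - 1) e \<le> (b - 1) (e - 1)\<close> whenever
  \<open>1 \<le> \<tau> \<le> e\<close> and \<open>\<tau> < b\<close>; a class covering \<open>B\<close> loses one.\<close>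

lemma global_slack:
  "(\<Sum>v\<in>B. \<Sum>u\<in>B - {v}. slack v u)
   + (\<Sum>H\<in>C. (int (card B) - 1) * (int (card H) - 1) + (if B \<subseteq> \<Union>H then int (card B) - 1 else 0)
       - (int (support H) - 1) * int (card H))
   = (int (card B) - 1) * (weight + int (card covering) - int k * int (card B))"
proof -
  have "(\<Sum>v\<in>B. \<Sum>H\<in>{H \<in> C. v \<in> \<Union>H}. int (card H) - int (deg H v))
      = (\<Sum>H\<in>C. \<Sum>v\<in>{v \<in> B. v \<in> \<Union>H}. int (card H) - int (deg H v))"
    by (rule sum.swap_restrict) (use finB finC in auto)
  \<comment> \<open>Over the vertices of \<open>B\<close> met by \<open>H\<close>, the term
    \<open>card H\<close> is counted \<open>support H\<close> times, and the degrees subtract it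
    once.\<close>
  also have "\<dots> = (\<Sum>H\<in>C. (int (support H) - 1) * int (card H))"
  proof (rule sum.cong)
    fix H assume H: "H \<in> C"
    have "(\<Sum>v\<in>{v \<in> B. v \<in> \<Union>H}. deg H v) = (\<Sum>v\<in>B. deg H v)"
      by (rule sum.mono_neutral_left) (use finB deg_pos_iff[OF H] in auto)
    then have "(\<Sum>v\<in>{v \<in> B. v \<in> \<Union>H}. int (deg H v)) = int (card H)"
      using card_eq_sum_deg[OF H] by (metis of_nat_sum)
    moreover have "card {v \<in> B. v \<in> \<Union>H} = support H"
      unfolding support_def by (rule arg_cong[of _ _ card]) auto
    ultimately show "(\<Sum>v\<in>{v \<in> B. v \<in> \<Union>H}. int (card H) - int (deg H v))
        = (int (support H) - 1) * int (card H)"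
      by (simp add: sum_subtractf algebra_simps)
  qed simp
  finally have 1: "(\<Sum>v\<in>B. \<Sum>u\<in>B - {v}. slack v u)
      = (\<Sum>H\<in>C. (int (support H) - 1) * int (card H)) - int (card B) * (int k * (int (card B) - 1))"
    using sum_slack by (simp add: sum_subtractf)
  have "(\<Sum>H\<in>C. if B \<subseteq> \<Union>H then int (card B) - 1 else 0) = int (card covering) * (int (card B) - 1)"
    unfolding covering_def using finC by (simp add: sum.If_cases Int_def)
  then show ?thesis unfolding 1 weight_def
    by (simp add: sum_subtractf sum.distrib sum_distrib_left[symmetric] algebra_simps)
qed

lemma weight_ge_covering:
  assumes "2 \<le> card B"
  shows "int k * int (card B) - int (card covering) \<le> weight"
proof -
  have "0 \<le> (int (card B) - 1) * (weight + int (card covering) - int k * int (card B))"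
    unfolding global_slack[symmetric]
    by (intro add_nonneg_nonneg sum_nonneg slack_nonneg class_slack_nonneg) auto
  then show ?thesis using assms by (simp add: zero_le_mult_iff)
qed

text \<open>The left side of \<open>global_slack\<close> is a sum of non-negative terms; equality in
  the bound makes all of them vanish.\<close>

lemma tight:
  assumes "2 \<le> card B" "weight \<le> int k * int (card B) - int (card covering)"
  shows "\<And>u v. u \<in> B \<Longrightarrow> v \<in> B \<Longrightarrow> u \<noteq> v \<Longrightarrow> slack v u = 0"
    and "\<And>H. H \<in> C \<Longrightarrow> (int (card B) - 1) * (int (card H) - 1)
      + (if B \<subseteq> \<Union>H then int (card B) - 1 else 0) = (int (support H) - 1) * int (card H)"
proof -
  let ?X = "\<lambda>v. \<Sum>u\<in>B - {v}. slack v u"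
  let ?Y = "\<lambda>H. (int (card B) - 1) * (int (card H) - 1)
      + (if B \<subseteq> \<Union>H then int (card B) - 1 else 0) - (int (support H) - 1) * int (card H)"
  have s0: "0 \<le> slack v u" if "v \<in> B" "u \<in> B - {v}" for u v
    using that by (intro slack_nonneg) auto
  have X: "0 \<le> ?X v" if "v \<in> B" for v using s0 that by (intro sum_nonneg) auto
  have Y: "0 \<le> ?Y H" if "H \<in> C" for H using class_slack_nonneg[OF that] .
  have "(\<Sum>v\<in>B. ?X v) + (\<Sum>H\<in>C. ?Y H) \<le> 0"
    unfolding global_slack using assms by (simp add: mult_le_0_iff)
  moreover have "0 \<le> (\<Sum>v\<in>B. ?X v)" "0 \<le> (\<Sum>H\<in>C. ?Y H)"
    using X Y by (auto intro: sum_nonneg)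
  ultimately have "(\<Sum>v\<in>B. ?X v) = 0" "(\<Sum>H\<in>C. ?Y H) = 0" by linarith+
  then have X0: "\<forall>v\<in>B. ?X v = 0" and Y0: "\<forall>H\<in>C. ?Y H = 0"
    using sum_nonneg_eq_0_iff[of B ?X] sum_nonneg_eq_0_iff[of C ?Y] finB finC X Y by auto
  show "\<And>u v. u \<in> B \<Longrightarrow> v \<in> B \<Longrightarrow> u \<noteq> v \<Longrightarrow> slack v u = 0"
  proof -
    fix u v assume uv: "u \<in> B" "v \<in> B" "u \<noteq> v"
    have "(\<Sum>u\<in>B - {v}. slack v u) = 0" using X0 uv by auto
    then have "\<forall>u\<in>B - {v}. slack v u = 0"
      using sum_nonneg_eq_0_iff[of "B - {v}" "slack v"] finB s0 uv by auto
    then show "slack v u = 0" using uv by auto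
  qed
  show "\<And>H. H \<in> C \<Longrightarrow> (int (card B) - 1) * (int (card H) - 1)
      + (if B \<subseteq> \<Union>H then int (card B) - 1 else 0) = (int (support H) - 1) * int (card H)"
    using Y0 by auto
qed

section \<open>Stars and covering classes\<close>

lemma class_unique: "H \<in> C \<Longrightarrow> H' \<in> C \<Longrightarrow> e \<in> H \<Longrightarrow> e \<in> H' \<Longrightarrow> H = H'"
  using disjC by blast

lemma edge_other_side:
  assumes "H \<in> C" "{u, w} \<in> H" "u \<in> B"
  shows "w \<in> A"
proof -
  obtain x y where "{u, w} = {x, y}" "x \<in> A" "y \<in> B" using edgeE[OF assms(1,2)] by metis
  then show ?thesis using assms(3) disj by (auto simp: doubleton_eq_iff)
qed

text \<open>Fix the end \<open>x\<close> in \<open>A\<close> of some edge. An edge of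
  \<open>H\<close> avoiding \<open>x\<close> but meeting an edge at \<open>x\<close> would share its
  end in \<open>B\<close>, which would then have degree 2; connectedness does the rest.\<close>

lemma star_if_deg_le_1:
  assumes "H \<in> C" "\<And>v. v \<in> B \<Longrightarrow> deg H v \<le> 1"
  obtains x where "x \<in> A" "\<And>e. e \<in> H \<Longrightarrow> x \<in> e"
proof -
  obtain e0 where e0: "e0 \<in> H" using neC assms by (metis all_not_in_conv)
  obtain x y where xy: "e0 = {x, y}" "x \<in> A" "y \<in> B" using edgeE[OF assms(1) e0] by metis
  define F where "F = {e \<in> H. x \<in> e}"
  have "F = H"
  proof (rule ccontr)
    assume "F \<noteq> H"
    moreover have "F \<subseteq> H" "F \<noteq> {}" using e0 xy unfolding F_def by auto
    ultimately obtain e f where ef: "e \<in> H - F" "f \<in> F" "e \<inter> f \<noteq> {}"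
      using conn[OF assms(1)] unfolding conn_edges_def by meson
    then have H: "e \<in> H" "f \<in> H" "x \<in> f" "x \<notin> e" unfolding F_def by auto
    obtain x' y' where f: "f = {x', y'}" "x' \<in> A" "y' \<in> B" using edgeE[OF assms(1) H(2)] by metis
    then have "y' \<in> e" using H ef(3) xy disj by auto
    then have "{e, f} \<subseteq> {e \<in> H. y' \<in> e}" "e \<noteq> f" using H f by auto
    then have "2 \<le> deg H y'" unfolding deg_def
      using card_mono[of "{e \<in> H. y' \<in> e}" "{e, f}"] finH[OF assms(1)] by simp
    then show False using assms(2)[OF f(3)] by simp
  qed
  then show ?thesis using that xy unfolding F_def by blast
qed

text \<open>Otherwise \<open>H\<close> is a star that contains every edge from its centre
  \<open>x\<close> to \<open>B\<close>. Any path leaving \<open>x\<close> then runs inside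
  \<open>H\<close>, so none can end at another vertex of \<open>A\<close>.\<close>

lemma covering_deg_ge_2:
  assumes "H \<in> covering" "2 \<le> card A"
  obtains v where "v \<in> B" "2 \<le> deg H v"
proof -
  have H: "H \<in> C" "B \<subseteq> \<Union>H" using assms(1) unfolding covering_def by auto
  have "\<exists>v\<in>B. 2 \<le> deg H v"
  proof (rule ccontr)
    assume "\<not> ?thesis"
    then have "\<And>v. v \<in> B \<Longrightarrow> deg H v \<le> 1" by force
    then obtain x where x: "x \<in> A" "\<And>e. e \<in> H \<Longrightarrow> x \<in> e"
      using star_if_deg_le_1[OF H(1)] by metis
    have "A \<noteq> {x}" using assms(2) by auto
    then obtain x' where x': "x' \<in> A" "x' \<noteq> x" using x(1) by blast
    interpret S: mono_bipartite B A C k by (rule swap)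
    obtain Ps where Ps: "linkage C k x x' Ps" using ex_linkage x x' by blast
    then obtain P H' where P: "H' \<in> C" "is_path H' P x x'"
      unfolding linkage_def using k2 by (metis length_greater_0_conv less_le_trans nth_mem pos2)
    have "P ! 1 \<in> B" using S.edge_other_side[OF P(1) is_path_second(1)[OF P(2)] x(1)] .
    then obtain e where e: "e \<in> H" "P ! 1 \<in> e" using H by auto
    obtain a b where "e = {a, b}" "a \<in> A" "b \<in> B" using edgeE[OF H(1) e(1)] by metis
    then have "e = {x, P ! 1}" using x(1) x(2)[OF e(1)] e(2) \<open>P ! 1 \<in> B\<close> disj by auto
    then have "H' = H" using class_unique[OF P(1) H(1)] is_path_second(1)[OF P(2)] e(1) by metis
    then have "{x', rev P ! 1} \<in> H" using is_path_second(1)[OF is_path_rev[OF P(2)]] by simp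
    then have "rev P ! 1 \<in> B" "x = rev P ! 1"
      using S.edge_other_side[OF H(1) _ x'(1)] x(2) x'(2) by auto
    then show False using x(1) disj by auto
  qed
  then show ?thesis using that by blast
qed

text \<open>One unit above \<open>k (card B - 1)\<close> comes from \<open>deg H0 v \<ge> 2\<close>.
  The other comes from \<open>deg H1 v \<ge> 2\<close>, or else from
  \<open>deg H1 v = 1 < deg H1 u\<close>, which makes \<open>slack v u\<close> positive.\<close>

lemma weight_ge_two_covering:
  assumes "2 \<le> card covering" "2 \<le> card A"
  shows "int k * (int (card B) - 1) + 2 \<le> weight"
proof -
  have "\<not> card covering \<le> Suc 0" using assms(1) by simp
  moreover have "finite covering" unfolding covering_def using finC by simp
  ultimately obtain H0 H1 where H: "H0 \<in> covering" "H1 \<in> covering" "H0 \<noteq> H1"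
    using card_le_Suc0_iff_eq by blast
  then have HC: "H0 \<in> C" "H1 \<in> C" unfolding covering_def by auto
  obtain v where v: "v \<in> B" "2 \<le> deg H0 v" using covering_deg_ge_2[OF H(1) assms(2)] .
  obtain u where u: "u \<in> B" "2 \<le> deg H1 u" using covering_deg_ge_2[OF H(2) assms(2)] .
  let ?S = "{H \<in> C. v \<in> \<Union>H}"
  have sub: "{H0, H1} \<subseteq> ?S" using H v(1) unfolding covering_def by blast
  have fS: "finite ?S" using finC by auto
  have nn: "0 \<le> int (deg H' v) - 1" if "H' \<in> ?S" for H'
  proof -
    have "0 < deg H' v" using that deg_pos_iff[of H' v] by blast
    then show ?thesis by simp
  qed
  have "(\<Sum>H\<in>{H0, H1}. int (deg H v) - 1) \<le> (\<Sum>H\<in>?S. int (deg H v) - 1)"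
    by (rule sum_mono2) (use sub fS nn in auto)
  then have ex: "int (deg H0 v) - 1 + (int (deg H1 v) - 1) \<le> (\<Sum>H\<in>?S. int (deg H v) - 1)"
    using H(3) by simp
  have nnH: "1 \<le> int (deg H1 v)" using nn[of H1] sub by auto
  have sl: "0 \<le> slack v w" if "w \<in> B - {v}" for w using that v by (intro slack_nonneg) auto
  have sl0: "0 \<le> (\<Sum>w\<in>B - {v}. slack v w)" using sl by (rule sum_nonneg)
  show ?thesis
  proof (cases "2 \<le> deg H1 v")
    case True
    then show ?thesis using weight_ge_local[OF v(1)] ex sl0 v(2) by linarith
  next
    case False
    then have uv: "u \<noteq> v" using u(2) by auto
    have "int (deg H1 u) - int (min (deg H1 u) (deg H1 v)) \<le> slack v u"
      using slack_ge[of u v H1] u(1) v(1) uv HC sub by blast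
    then have "1 \<le> slack v u" using False u(2) nnH by simp
    moreover have "slack v u \<le> (\<Sum>w\<in>B - {v}. slack v w)"
      by (rule member_le_sum) (use u(1) uv sl finB in auto)
    ultimately show ?thesis using weight_ge_local[OF v(1)] ex v(2) nnH by linarith
  qed
qed

lemma weight_ge_card_covering: "int (card covering) * (int (card B) - 1) \<le> weight"
proof -
  have "(\<Sum>H\<in>covering. int (card B) - 1) \<le> (\<Sum>H\<in>covering. int (card H) - 1)"
  proof (rule sum_mono)
    fix H assume "H \<in> covering"
    then have "H \<in> C" "support H = card B" unfolding covering_def using support_eq_iff by auto
    then show "int (card B) - 1 \<le> int (card H) - 1" using support_le_card[of H] by simp
  qed
  also have "\<dots> \<le> weight" unfolding weight_def
  proof (rule sum_mono2)
    show "0 \<le> int (card H) - 1" if "H \<in> C - covering" for H using that card_pos[of H] by simp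
  qed (use finC in \<open>auto simp: covering_def\<close>)
  finally show ?thesis by simp
qed

text \<open>Since \<open>card B - 1\<close> is at least 1, the number of covering classes is itself
  at most \<open>weight\<close>.\<close>

lemma weight_ge_half:
  assumes "2 \<le> card B"
  shows "int k * int (card B) \<le> 2 * weight"
proof -
  have "int (card covering) * 1 \<le> int (card covering) * (int (card B) - 1)"
    using assms by (intro mult_left_mono) auto
  then show ?thesis using weight_ge_covering[OF assms] weight_ge_card_covering by linarith
qed

text \<open>The second vertices of a linkage starting in \<open>B\<close> fill all of
  \<open>A\<close>, by counting. Hence all edges at a fixed vertex of \<open>A\<close> lie in one
  class, and a suitable path carries this class to any other vertex of \<open>A\<close>.\<close>

lemma single_class:
  assumes "card A = k" "2 \<le> card B" "H \<in> C" "H' \<in> C"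
  shows "H = H'"
proof -
  interpret S: mono_bipartite B A C k by (rule swap)
  have surj: "(\<lambda>i. Ps ! i ! 1) ` {..<k} = A" if Ps: "linkage C k u v Ps" and u: "u \<in> B" for u v Ps
  proof (rule card_subset_eq[OF finA])
    show "(\<lambda>i. Ps ! i ! 1) ` {..<k} \<subseteq> A"
    proof
      fix x assume "x \<in> (\<lambda>i. Ps ! i ! 1) ` {..<k}"
      then obtain i where i: "i < k" "x = Ps ! i ! 1" by auto
      then have "Ps ! i \<in> set Ps" using Ps unfolding linkage_def by auto
      then obtain H where "H \<in> C" "is_path H (Ps ! i) u v" using Ps unfolding linkage_def by blast
      then show "x \<in> A" using edge_other_side is_path_second(1) u i by metis
    qed
    show "card ((\<lambda>i. Ps ! i ! 1) ` {..<k}) = card A"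
      using card_image[OF linkage_second_inj[OF Ps]] assms(1) by simp
  qed
  have same: "\<exists>H\<in>C. {u, x} \<in> H \<and> {v, x} \<in> H" if uv: "u \<in> B" "v \<in> B" "u \<noteq> v" and x: "x \<in> A" for u v x
  proof -
    obtain Ps where Ps: "linkage C k u v Ps" using ex_linkage uv by blast
    have len: "length Ps = k" using Ps unfolding linkage_def by simp
    have "x \<in> (\<lambda>i. Ps ! i ! 1) ` {..<k}" "x \<in> (\<lambda>i. map rev Ps ! i ! 1) ` {..<k}"
      using surj[OF Ps uv(1)] surj[OF linkage_rev[OF Ps] uv(2)] x by auto
    then obtain i j where ij: "i < k" "x = Ps ! i ! 1" "j < k" "x = rev (Ps ! j) ! 1"
      using len by auto
    obtain H where H: "H \<in> C" "is_path H (Ps ! i) u v"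
      using Ps ij(1) len unfolding linkage_def by (metis nth_mem)
    obtain H' where H': "H' \<in> C" "is_path H' (Ps ! j) u v"
      using Ps ij(3) len unfolding linkage_def by (metis nth_mem)
    have "x \<noteq> u" "x \<noteq> v" using x uv disj by auto
    then have "x \<in> interior (Ps ! i)" "x \<in> interior (Ps ! j)"
      using is_path_second(5)[OF H(2)] is_path_second(5)[OF is_path_rev[OF H'(2)]] ij
      by (auto simp: interior_rev)
    \<comment> \<open>\<open>x\<close> is the second vertex of one path and the last but one of
      another; as an interior vertex of both it makes them the same path, so its edges to
      \<open>u\<close> and \<open>v\<close> share a class.\<close>
    then have "i = j" using Ps ij unfolding linkage_def by blast
    then have "{u, x} \<in> H" "{v, x} \<in> H"
      using is_path_second(1)[OF H(2)] is_path_second(1)[OF is_path_rev[OF H(2)]] ij by auto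
    then show ?thesis using H by blast
  qed
  obtain e e' where e: "e \<in> H" "e' \<in> H'" using neC assms by (metis all_not_in_conv)
  obtain x w where xw: "e = {x, w}" "x \<in> A" "w \<in> B" using edgeE[OF assms(3) e(1)] by metis
  obtain y v where yv: "e' = {y, v}" "y \<in> A" "v \<in> B" using edgeE[OF assms(4) e(2)] by metis
  have "v \<noteq> x" using xw yv disj by auto
  \<comment> \<open>The path of this linkage that leaves \<open>v\<close> through \<open>y\<close>
    lies in \<open>H'\<close>, and it enters \<open>x\<close>; so \<open>H'\<close> occurs at
    \<open>x\<close>, as does \<open>H\<close>.\<close>
  then obtain Ps where Ps: "linkage C k v x Ps" using ex_linkage[of v x] xw yv by blast
  have "y \<in> (\<lambda>i. Ps ! i ! 1) ` {..<k}" using surj[OF Ps yv(3)] yv(2) by simp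
  then obtain i where i: "i < k" "y = Ps ! i ! 1" by auto
  then have "Ps ! i \<in> set Ps" using Ps unfolding linkage_def by auto
  then obtain K where K: "K \<in> C" "is_path K (Ps ! i) v x" using Ps unfolding linkage_def by blast
  then have "{v, y} \<in> K" using is_path_second(1) i by metis
  then have "K = H'" using class_unique[OF K(1) assms(4)] e(2) yv(1) by (simp add: insert_commute)
  define z where "z = rev (Ps ! i) ! 1"
  have z: "{x, z} \<in> H'" using is_path_second(1)[OF is_path_rev[OF K(2)]] \<open>K = H'\<close> z_def by simp
  then have zB: "z \<in> B" using S.edge_other_side[OF assms(4) _ xw(2)] by blast
  show ?thesis
  proof (cases "z = w")
    case True
    then show ?thesis using z e(1) xw(1) class_unique assms by blast
  next
    case False
    then obtain J where J: "J \<in> C" "{z, x} \<in> J" "{w, x} \<in> J" using same[OF zB xw(3) _ xw(2)] by blast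
    then have "J = H'" "J = H"
      using class_unique[OF J(1) assms(4)] class_unique[OF J(1) assms(3)] z e(1) xw(1)
      by (simp_all add: insert_commute)
    then show ?thesis by simp
  qed
qed

section \<open>Sides of equal size\<close>

lemma weight_ge_both_coverings:
  assumes "card A = card B"
  shows "(int (card covering) + int (card (mono_bipartite.covering A C))) * (int (card B) - 1) \<le> weight"
proof -
  interpret S: mono_bipartite B A C k by (rule swap)
  have "(\<Sum>H\<in>C. (if B \<subseteq> \<Union>H then int (card B) - 1 else 0) + (if A \<subseteq> \<Union>H then int (card B) - 1 else 0))
      \<le> weight"
    unfolding weight_def
  proof (rule sum_mono)
    fix H assume H: "H \<in> C"
    have 1: "int (card B) \<le> int (card H)" if "B \<subseteq> \<Union>H"
      using support_le_card[OF H] support_eq_iff[of H] that by simp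
    have 2: "int (card B) \<le> int (card H)" if "A \<subseteq> \<Union>H"
      using S.support_le_card[OF H] S.support_eq_iff[of H] that assms by simp
    \<comment> \<open>A class covering both sides has to pay \<open>card B - 1\<close> twice. It
      can, because a connected class on \<open>2 * card B\<close> vertices has at least
      \<open>2 * card B - 1\<close> edges.\<close>
    have 3: "2 * int (card B) \<le> int (card H) + 1" if "A \<subseteq> \<Union>H" "B \<subseteq> \<Union>H"
    proof -
      have e2: "card e = 2" if "e \<in> H" for e
      proof -
        obtain x y where "e = {x, y}" "x \<noteq> y" using edgeE[OF H \<open>e \<in> H\<close>] by metis
        then show ?thesis by simp
      qed
      have "finite (\<Union>H)" using finH[OF H] e2 by (metis card.infinite finite_Union zero_neq_numeral)
      then have "card (A \<union> B) \<le> card (\<Union>H)" using that by (intro card_mono) auto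
      also have "\<dots> \<le> card H + 1"
        using conn_edges_card[OF conn[OF H] finH[OF H] _ e2] H neC by blast
      finally show ?thesis using card_Un_disjoint[OF finA finB disj] assms by simp
    qed
    show "(if B \<subseteq> \<Union>H then int (card B) - 1 else 0) + (if A \<subseteq> \<Union>H then int (card B) - 1 else 0)
        \<le> int (card H) - 1"
      using 1 2 3 card_pos[OF H] by auto
  qed
  moreover have "(\<Sum>H\<in>C. if B \<subseteq> \<Union>H then int (card B) - 1 else 0)
      = int (card covering) * (int (card B) - 1)"
    unfolding covering_def using finC by (simp add: sum.If_cases Int_def)
  moreover have "(\<Sum>H\<in>C. if A \<subseteq> \<Union>H then int (card B) - 1 else 0)
      = int (card S.covering) * (int (card B) - 1)"
    unfolding S.covering_def using finC by (simp add: sum.If_cases Int_def)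
  ultimately show ?thesis by (simp add: sum.distrib algebra_simps)
qed

text \<open>If the bound fails, the two covering numbers add up to at least
  \<open>card B + 1\<close>, so \<open>weight\<close> is at least
  \<open>(card B)\<^sup>2 - 1 \<ge> k * card B - 1\<close>, which is more than the bound asks
  for.\<close>

lemma weight_ge_balanced:
  assumes "card A = card B" "k \<le> card B"
  shows "2 * (int k * int (card B)) - int (card B) \<le> 2 * weight + 1"
proof -
  interpret S: mono_bipartite B A C k by (rule swap)
  have b2: "2 \<le> card B" using k2 assms by simp
  have 1: "int k * int (card B) - int (card covering) \<le> weight"
    "int k * int (card B) - int (card S.covering) \<le> weight"
    using weight_ge_covering[OF b2] S.weight_ge_covering assms b2 by simp_all
  show ?thesis
  proof (rule ccontr)
    assume *: "\<not> ?thesis"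
    then have "int (card B) + 1 \<le> int (card covering) + int (card S.covering)" using 1 by linarith
    then have "(int (card B) + 1) * (int (card B) - 1)
        \<le> (int (card covering) + int (card S.covering)) * (int (card B) - 1)"
      using b2 by (intro mult_right_mono) auto
    also have "\<dots> \<le> weight" by (rule weight_ge_both_coverings[OF assms(1)])
    finally have "int (card B) * int (card B) - 1 \<le> weight" by (simp add: algebra_simps)
    moreover have "int k * int (card B) \<le> int (card B) * int (card B)"
      using assms by (intro mult_right_mono) auto
    ultimately show False using * b2 by linarith
  qed
qed

text \<open>In a connected class that is a Hamiltonian cycle, the two arcs between \<open>u\<close> and \<open>v\<close> exhaust all
  vertices, so that no third path can be disjoint from them.\<close>

lemma two_regular_linkage:
  assumes H: "H \<in> C" "A \<subseteq> \<Union>H" "\<And>w. w \<in> A \<union> B \<Longrightarrow> deg H w = 2"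
    and uv: "u \<in> B" "v \<in> B" and Ps: "linkage C k u v Ps"
    and ij: "i < k" "j < k" "i \<noteq> j" "is_path H (Ps ! i) u v" "is_path H (Ps ! j) u v"
    and l: "l < k"
  shows "l = i \<or> l = j"
proof (rule ccontr)
  assume nl: "\<not> ?thesis"
  have len: "length Ps = k" using Ps unfolding linkage_def by simp
  define W where "W = set (Ps ! i) \<union> set (Ps ! j)"
  have HAB: "\<Union>H \<subseteq> A \<union> B" using edgeE[OF H(1)] by blast
  have two: "\<exists>e f. e \<in> H \<and> f \<in> H \<and> e \<noteq> f \<and> w \<in> e \<and> w \<in> f \<and> e \<subseteq> W \<and> f \<subseteq> W" if w: "w \<in> W" for w
  proof -
    have hl: "hd (Ps ! i) = u" "last (Ps ! i) = v" "hd (Ps ! j) = u" "last (Ps ! j) = v"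
      "u \<in> W" "v \<in> W"
      using is_path_ends[OF ij(4)] is_path_ends[OF ij(5)] unfolding W_def by auto
    consider "w = u" | "w = v" | "w \<in> interior (Ps ! i)" | "w \<in> interior (Ps ! j)"
      using w hl unfolding W_def interior_def by auto
    then show ?thesis
    proof cases
      case 1
      have "Ps ! i ! 1 \<noteq> Ps ! j ! 1" using linkage_second_inj[OF Ps] ij by (auto dest: inj_onD)
      moreover have "Ps ! i ! 1 \<in> W" "Ps ! j ! 1 \<in> W" "{u, Ps ! i ! 1} \<in> H" "{u, Ps ! j ! 1} \<in> H"
        using is_path_second(1,2)[OF ij(4)] is_path_second(1,2)[OF ij(5)] unfolding W_def by auto
      ultimately show ?thesis using 1 hl
        by (intro exI[of _ "{u, Ps ! i ! 1}"] exI[of _ "{u, Ps ! j ! 1}"]) (auto simp: doubleton_eq_iff)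
    next
      case 2
      have "rev (Ps ! i) ! 1 \<noteq> rev (Ps ! j) ! 1"
        using inj_onD[OF linkage_second_inj[OF linkage_rev[OF Ps]], of i j] ij len by auto
      moreover have "rev (Ps ! i) ! 1 \<in> W" "rev (Ps ! j) ! 1 \<in> W"
        "{v, rev (Ps ! i) ! 1} \<in> H" "{v, rev (Ps ! j) ! 1} \<in> H"
        using is_path_second(1,2)[OF is_path_rev[OF ij(4)]] is_path_second(1,2)[OF is_path_rev[OF ij(5)]]
        unfolding W_def by auto
      ultimately show ?thesis using 2 hl
        by (intro exI[of _ "{v, rev (Ps ! i) ! 1}"] exI[of _ "{v, rev (Ps ! j) ! 1}"])
          (auto simp: doubleton_eq_iff)
    next
      case 3
      then show ?thesis using is_path_inner_edges[OF ij(4)] unfolding W_def by (metis le_supI1)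
    next
      case 4
      then show ?thesis using is_path_inner_edges[OF ij(5)] unfolding W_def by (metis le_supI2)
    qed
  qed
  \<comment> \<open>The two paths supply two edges inside \<open>W\<close> at every vertex of
    \<open>W\<close>, and the degree allows no further edge.\<close>
  have closed: "e \<subseteq> W" if w: "w \<in> W" "w \<in> e" "e \<in> H" for w e
  proof -
    obtain e1 e2 where e12: "e1 \<in> H" "e2 \<in> H" "e1 \<noteq> e2" "w \<in> e1" "w \<in> e2" "e1 \<subseteq> W" "e2 \<subseteq> W"
      using two[OF w(1)] by blast
    have "w \<in> A \<union> B" using w HAB by blast
    then have "card {e \<in> H. w \<in> e} = card {e1, e2}" using H(3) e12(3) unfolding deg_def by simp
    moreover have "{e1, e2} \<subseteq> {e \<in> H. w \<in> e}" using e12 by auto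
    ultimately have "{e1, e2} = {e \<in> H. w \<in> e}" using finH[OF H(1)] by (intro card_subset_eq) auto
    then show ?thesis using w e12 by blast
  qed
  have "{e \<in> H. e \<subseteq> W} = H"
  proof (rule ccontr)
    assume "{e \<in> H. e \<subseteq> W} \<noteq> H"
    moreover have "{e \<in> H. e \<subseteq> W} \<noteq> {}"
    proof -
      have "u \<in> W" using is_path_ends[OF ij(4)] unfolding W_def by auto
      then show ?thesis using two by blast
    qed
    ultimately obtain e f where "e \<in> H - {e \<in> H. e \<subseteq> W}" "f \<in> {e \<in> H. e \<subseteq> W}" "e \<inter> f \<noteq> {}"
      using conn[OF H(1)] unfolding conn_edges_def by (metis (no_types, lifting) mem_Collect_eq subsetI)
    then show False using closed by blast
  qed
  then have AW: "A \<subseteq> W" using H(2) by blast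
  \<comment> \<open>The class of the third path is arbitrary: its second vertex lies in
    \<open>A\<close>, hence on one of the first two paths.\<close>
  obtain K where K: "K \<in> C" "is_path K (Ps ! l) u v"
    using Ps l len unfolding linkage_def by (metis nth_mem)
  define x where "x = Ps ! l ! 1"
  have "x \<in> A" using edge_other_side[OF K(1) is_path_second(1)[OF K(2)] uv(1)] x_def by simp
  then have x: "x \<in> W" "x \<noteq> u" "x \<noteq> v" using AW uv disj by auto
  then have "x \<in> interior (Ps ! l)" using is_path_second(5)[OF K(2)] x_def by simp
  moreover have "x \<in> interior (Ps ! i) \<union> interior (Ps ! j)"
    using x ij unfolding W_def interior_def is_path_def by auto
  ultimately show False using Ps ij l nl unfolding linkage_def by blast
qed

text \<open>The hypotheses express equality in \<open>weight_ge_covering\<close> with two covering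
  classes. Vanishing class terms make all other classes single edges; vanishing slacks make the
  covering classes regular on \<open>B\<close> with total degree \<open>k\<close>.\<close>

lemma tight_two_coverings:
  assumes "card A = card B" "k < card B" "weight \<le> int k * int (card B) - 2" "card covering = 2"
  shows "\<And>H. H \<in> C \<Longrightarrow> card H = 1 \<or> H \<in> covering"
    and "\<And>H u v. H \<in> covering \<Longrightarrow> u \<in> B \<Longrightarrow> v \<in> B \<Longrightarrow> deg H u = deg H v"
    and "\<And>u. u \<in> B \<Longrightarrow> (\<Sum>H\<in>covering. deg H u) = k"
proof -
  interpret S: mono_bipartite B A C k by (rule swap)
  have b2: "2 \<le> card B" using k2 assms by simp
  have wt: "weight \<le> int k * int (card B) - int (card covering)" using assms by simp
  note t1 = tight(1)[OF b2 wt] and t2 = tight(2)[OF b2 wt]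
  show triv: "card H = 1 \<or> H \<in> covering" if H: "H \<in> C" for H
  proof (rule ccontr)
    assume "\<not> ?thesis"
    then have ns: "\<not> B \<subseteq> \<Union>H" and c1: "card H \<noteq> 1" using H unfolding covering_def by auto
    have c2: "2 \<le> card H" using card_pos[OF H] c1 by linarith
    (* Tightness leaves only a star with b - 1 edges, whose centre violates the local bound. *)
    define x where "x = int (card B) - int (support H)"
    have x1: "1 \<le> x" using ns support_eq_iff[of H] support_le[of H] unfolding x_def by auto
    have "(int (card B) - 1) * (int (card H) - 1) = (int (support H) - 1) * int (card H)"
      using t2[OF H] ns by simp
    then have "(int (card H) - 1) * (x - 1) + (int (card H) - int (support H)) = 0"
      unfolding x_def by (simp add: algebra_simps)
    moreover have "0 \<le> (int (card H) - 1) * (x - 1)" using x1 c2 by (intro mult_nonneg_nonneg) auto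
    moreover have "int (support H) \<le> int (card H)" using support_le_card[OF H] by simp
    ultimately have "(int (card H) - 1) * (x - 1) = 0" and cs: "card H = support H" by linarith+
    then have "x = 1" using c2 by auto
    then have cb: "int (card H) = int (card B) - 1" using cs unfolding x_def by simp
    have deg1: "deg H v \<le> 1" if v: "v \<in> B" for v
    proof (rule ccontr)
      assume "\<not> deg H v \<le> 1"
      moreover from this have vH: "v \<in> B \<inter> \<Union>H" using v deg_pos_iff[OF H, of v] by simp
      moreover have "\<forall>u\<in>B \<inter> \<Union>H. 1 \<le> deg H u" using deg_pos_iff[OF H] by (simp add: Suc_leI)
      ultimately have "(\<Sum>u\<in>B \<inter> \<Union>H. 1) < (\<Sum>u\<in>B \<inter> \<Union>H. deg H u)"
        using finB by (intro sum_strict_mono_ex1 bexI[of _ v]) auto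
      also have "\<dots> \<le> (\<Sum>u\<in>B. deg H u)" using finB by (intro sum_mono2) auto
      also have "\<dots> = card H" using card_eq_sum_deg[OF H] by simp
      finally show False using cs unfolding support_def by simp
    qed
    obtain x where x: "x \<in> A" "\<And>e. e \<in> H \<Longrightarrow> x \<in> e" using star_if_deg_le_1[OF H deg1] by blast
    then have "{e \<in> H. x \<in> e} = H" by auto
    then have "deg H x = card H" unfolding deg_def by simp
    \<comment> \<open>With \<open>card H = card B - 1\<close> the left side is
      \<open>k * card B - 2 + (card B - k)\<close>, too large because
      \<open>k < card B\<close>.\<close>
    then have "int k * (int (card B) - 1) + int (card H) - 1 \<le> weight"
      using S.weight_ge_excess[OF x(1) H] card_pos[OF H] assms(1) by simp
    then show False using cb assms by (simp add: algebra_simps)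
  qed
  have le: "deg H u \<le> deg H v" if "H \<in> covering" "u \<in> B" "v \<in> B" for H u v
  proof (cases "u = v")
    case False
    have H: "H \<in> C" "v \<in> \<Union>H" using that unfolding covering_def by auto
    have "int (deg H u) - int (min (deg H u) (deg H v)) \<le> 0"
      using slack_ge[of u v H] t1[of u v] that False H by simp
    then show ?thesis by simp
  qed simp
  show "deg H u = deg H v" if "H \<in> covering" "u \<in> B" "v \<in> B" for H u v
    using le[OF that] le[OF that(1,3,2)] by simp
  show "(\<Sum>H\<in>covering. deg H u) = k" if u: "u \<in> B" for u
  proof -
    have "B \<noteq> {u}" using b2 by auto
    then obtain v where v: "v \<in> B" "v \<noteq> u" using u by blast
    have "(\<Sum>H\<in>{H \<in> C. v \<in> \<Union>H}. deg H u) = (\<Sum>H\<in>covering. deg H u)"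
    proof (rule sum.mono_neutral_right)
      show "covering \<subseteq> {H \<in> C. v \<in> \<Union>H}" using v unfolding covering_def by blast
      show "\<forall>H\<in>{H \<in> C. v \<in> \<Union>H} - covering. deg H u = 0"
      proof
        \<comment> \<open>A non-covering class meeting \<open>v\<close> is a single edge at
          \<open>v\<close>; it avoids \<open>u\<close>, since both lie in \<open>B\<close>.\<close>
        fix H assume "H \<in> {H \<in> C. v \<in> \<Union>H} - covering"
        then have H: "H \<in> C" "v \<in> \<Union>H" "card H = 1" using triv by auto
        then obtain e where e: "H = {e}" by (metis card_1_singletonE)
        obtain a b where ab: "e = {a, b}" "a \<in> A" "b \<in> B" using edgeE[OF H(1), of e] e by blast
        have "u \<notin> e" using ab e H(2) u v disj by auto
        then show "deg H u = 0" using e unfolding deg_def by auto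
      qed
    qed (use finC in auto)
    moreover have "(\<Sum>H\<in>{H \<in> C. v \<in> \<Union>H}. int (deg H u)) = int k"
      using t1[OF u v(1)] v(2) unfolding slack_def by simp
    ultimately show ?thesis by (metis of_nat_eq_iff of_nat_sum)
  qed
qed

lemma two_coverings_impossible:
  assumes "card A = card B" "k < card B" "weight \<le> int k * int (card B) - 2" "card covering = 2" "k \<le> 5"
  shows False
proof -
  interpret S: mono_bipartite B A C k by (rule swap)
  have b2: "2 \<le> card B" using k2 assms by simp
  note tB = tight_two_coverings[OF assms(1-4)]
  have fc: "finite covering" unfolding covering_def using finC by simp
  \<comment> \<open>A class covering \<open>A\<close> has at least two edges, so it is not one of
    the single edges and must cover \<open>B\<close> as well.\<close>
  have "S.covering \<subseteq> covering"
  proof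
    fix H assume "H \<in> S.covering"
    then have H: "H \<in> C" "S.support H = card A" unfolding S.covering_def using S.support_eq_iff by auto
    then have "card H \<noteq> 1" using S.support_le_card[of H] b2 assms(1) by simp
    then show "H \<in> covering" using tB(1) H(1) by blast
  qed
  moreover have "2 \<le> card S.covering"
    using S.weight_ge_covering assms b2 by simp
  ultimately have cov: "S.covering = covering"
    using fc assms(4) card_mono[of covering S.covering] by (intro card_subset_eq) auto
  have "card S.covering = 2" using cov assms(4) by simp
  then have regA: "deg H x = deg H y" if "H \<in> covering" "x \<in> A" "y \<in> A" for H x y
    using S.tight_two_coverings(2)[of H x y] assms(1-3) cov that by simp
  obtain H1 H2 where H12: "covering = {H1, H2}" "H1 \<noteq> H2" using assms(4) by (metis card_2_iff)
  have "B \<noteq> {}" using b2 by auto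
  then obtain b where b: "b \<in> B" by blast
  have main: False if H: "covering = {H, H'}" "H \<noteq> H'" "deg H b \<le> 2" for H H'
  proof -
    have HC: "H \<in> covering" "H' \<in> covering" "H \<in> C" "H' \<in> C" using H(1) unfolding covering_def by auto
    have A2: "2 \<le> card A" using b2 assms(1) by simp
    have ge2: "2 \<le> deg K b" if K: "K \<in> covering" for K
    proof -
      obtain v where "v \<in> B" "2 \<le> deg K v" using covering_deg_ge_2[OF K A2] .
      then show ?thesis using tB(2)[OF K, of v b] b by simp
    qed
    have d2: "deg H u = 2" if "u \<in> B" for u using tB(2)[OF HC(1) that b] ge2[OF HC(1)] H(3) by simp
    have cardH: "card H = 2 * card B" using card_eq_sum_deg[OF HC(3)] d2 by simp
    \<comment> \<open>Regularity on \<open>A\<close>, with the same number of edges counted over a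
      side of the same size, gives the same degree.\<close>
    have d2A: "deg H x = 2" if x: "x \<in> A" for x
    proof -
      have "card H = (\<Sum>y\<in>A. deg H y)" using S.card_eq_sum_deg[OF HC(3)] .
      also have "\<dots> = (\<Sum>y\<in>A. deg H x)"
        by (rule sum.cong[OF refl], rule regA[OF HC(1)]) (use x in auto)
      finally show ?thesis using cardH assms(1) b2 by simp
    qed
    have "B \<noteq> {b}" using b2 by auto
    then obtain v where v: "v \<in> B" "v \<noteq> b" using b by blast
    then obtain Ps where Ps: "linkage C k b v Ps" using ex_linkage[of b v] b by blast
    have len: "length Ps = k" using Ps unfolding linkage_def by simp
    let ?I = "\<lambda>K. {i. i < k \<and> is_path K (Ps ! i) b v}"
    \<comment> \<open>A class containing a path between two vertices of \<open>B\<close> has more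
      than one edge, so only \<open>H\<close> and \<open>H'\<close> can carry the paths.\<close>
    have "{..<k} \<subseteq> ?I H \<union> ?I H'"
    proof
      fix i assume i: "i \<in> {..<k}"
      then obtain K where K: "K \<in> C" "is_path K (Ps ! i) b v"
        using Ps len unfolding linkage_def by (metis lessThan_iff nth_mem)
      have "b \<in> \<Union>K" "v \<in> \<Union>K"
        using is_path_second(1)[OF K(2)] is_path_second(1)[OF is_path_rev[OF K(2)]] by blast+
      then have "{b, v} \<subseteq> B \<inter> \<Union>K" using b v by blast
      then have "2 \<le> support K" unfolding support_def
        using card_mono[of "B \<inter> \<Union>K" "{b, v}"] finB v(2) by simp
      then have "card K \<noteq> 1" using support_le_card[OF K(1)] by simp
      then have "K \<in> covering" using tB(1)[OF K(1)] by blast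
      then show "i \<in> ?I H \<union> ?I H'" using K i H(1) by auto
    qed
    then have "k \<le> card (?I H \<union> ?I H')" using card_mono[of "?I H \<union> ?I H'" "{..<k}"] by simp
    also have "\<dots> \<le> card (?I H) + card (?I H')" by (rule card_Un_le)
    finally have kle: "k \<le> card (?I H) + card (?I H')" .
    have "card (?I H') \<le> deg H' b" "card (?I H) \<le> deg H b"
      using linkage_class_le_deg[OF Ps finH] HC by auto
    moreover have "deg H b + deg H' b = k" using tB(3)[OF b] H(1,2) by simp
    \<comment> \<open>The degree bounds for the two classes add up to exactly \<open>k\<close>, so
      both are attained: two paths run along the cycle \<open>H\<close>, and at least two more in
      \<open>H'\<close>.\<close>
    ultimately have cI: "card (?I H) = 2" "4 \<le> k" using kle d2[OF b] ge2[OF HC(2)] by linarith+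
    then obtain i j where ij: "?I H = {i, j}" "i \<noteq> j" by (metis card_2_iff)
    have "\<not> {..<k} \<subseteq> {i, j}"
    proof
      assume "{..<k} \<subseteq> {i, j}"
      then have "card {..<k} \<le> card {i, j}" by (intro card_mono) auto
      then show False using cI ij(2) by simp
    qed
    then obtain l where l: "l < k" "l \<noteq> i" "l \<noteq> j" by auto
    have "i < k" "j < k" "is_path H (Ps ! i) b v" "is_path H (Ps ! j) b v" using ij by auto
    moreover have "A \<subseteq> \<Union>H" using cov HC(1) unfolding S.covering_def by auto
    moreover have "\<And>w. w \<in> A \<union> B \<Longrightarrow> deg H w = 2" using d2 d2A by blast
    ultimately show False using two_regular_linkage[OF HC(3) _ _ b v(1) Ps] ij(2) l by blast
  qed
  have "deg H1 b + deg H2 b = k" using tB(3)[OF b] H12 by simp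
  then have "deg H1 b \<le> 2 \<or> deg H2 b \<le> 2" using assms(5) by linarith
  then show False using main[of H1 H2] main[of H2 H1] H12 by (auto simp: insert_commute)
qed

lemma weight_ge_balanced_small:
  assumes "card A = card B" "k < card B" "k \<le> 5"
  shows "int k * int (card B) - 1 \<le> weight"
proof (rule ccontr)
  assume n: "\<not> ?thesis"
  interpret S: mono_bipartite B A C k by (rule swap)
  have b2: "2 \<le> card B" using k2 assms by simp
  have w: "weight \<le> int k * int (card B) - 2" using n by simp
  have ge: "2 \<le> card covering" "2 \<le> card S.covering"
    using weight_ge_covering[OF b2] S.weight_ge_covering assms b2 w by simp_all
  have "card covering \<noteq> 2" using two_coverings_impossible[OF assms(1,2) w] assms(3) by blast
  moreover have "card S.covering \<noteq> 2" using S.two_coverings_impossible assms w by auto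
  ultimately have "6 \<le> int (card covering) + int (card S.covering)" using ge by linarith
  then have "6 * (int (card B) - 1) \<le> (int (card covering) + int (card S.covering)) * (int (card B) - 1)"
    using b2 by (intro mult_right_mono) auto
  also have "\<dots> \<le> weight" by (rule weight_ge_both_coverings[OF assms(1)])
  finally have "6 * (int (card B) - 1) \<le> int k * int (card B) - 2" using w by linarith
  then have "(6 - int k) * int (card B) \<le> 4" by (simp add: algebra_simps)
  \<comment> \<open>As \<open>card B\<close> is at least \<open>k + 1\<close>, the previous line
    would give \<open>(6 - k) (k + 1) \<le> 4\<close>; for \<open>k\<close> from 2 to 5 the product
    is at least 6.\<close>
  moreover have "(6 - int k) * (int k + 1) \<le> (6 - int k) * int (card B)"
    using assms by (intro mult_left_mono) auto
  moreover have "k = 2 \<or> k = 3 \<or> k = 4 \<or> k = 5" using assms(3) k2 by linarith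
  ultimately show False by auto
qed

end

section \<open>From colourings to partitions\<close>

text \<open>The line graph restricted to pairs of equal colour; its components are the connected
  components of the colour classes.\<close>

definition adj_same_colour :: "'a set set \<Rightarrow> ('a set \<Rightarrow> 'c) \<Rightarrow> ('a set \<times> 'a set) set" where
  "adj_same_colour E c = {(e, f). e \<in> E \<and> f \<in> E \<and> c e = c f \<and> e \<inter> f \<noteq> {}}"

definition colour_components :: "'a set set \<Rightarrow> ('a set \<Rightarrow> 'c) \<Rightarrow> 'a set set set" where
  "colour_components E c = (\<lambda>e. (adj_same_colour E c)\<^sup>* `` {e}) ` E"

lemma sym_adj_same_colour: "sym ((adj_same_colour E c)\<^sup>*)"
  by (rule sym_rtrancl) (auto simp: sym_def adj_same_colour_def)

lemma adj_same_colour_rtrancl: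
  assumes "(e, f) \<in> (adj_same_colour E c)\<^sup>*" "e \<in> E"
  shows "f \<in> E \<and> c f = c e"
  using assms by (induction rule: rtrancl_induct) (auto simp: adj_same_colour_def)

lemma component_eq:
  assumes "(e, f) \<in> (adj_same_colour E c)\<^sup>*"
  shows "(adj_same_colour E c)\<^sup>* `` {e} = (adj_same_colour E c)\<^sup>* `` {f}"
  using assms symD[OF sym_adj_same_colour assms] by (auto intro: rtrancl_trans)

lemma Union_colour_components: "\<Union>(colour_components E c) = E"
proof
  show "\<Union>(colour_components E c) \<subseteq> E"
    unfolding colour_components_def using adj_same_colour_rtrancl[of _ _ E c] by blast
  show "E \<subseteq> \<Union>(colour_components E c)" unfolding colour_components_def by blast
qed

lemma colour_components_disjoint:
  assumes "H \<in> colour_components E c" "H' \<in> colour_components E c" "H \<noteq> H'"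
  shows "H \<inter> H' = {}"
proof (rule ccontr)
  assume "H \<inter> H' \<noteq> {}"
  then obtain f where "f \<in> H" "f \<in> H'" by blast
  obtain e e' where e: "H = (adj_same_colour E c)\<^sup>* `` {e}" "H' = (adj_same_colour E c)\<^sup>* `` {e'}"
    using assms unfolding colour_components_def by blast
  then have "H = (adj_same_colour E c)\<^sup>* `` {f}" "H' = (adj_same_colour E c)\<^sup>* `` {f}"
    using component_eq[of e f E c] component_eq[of e' f E c] \<open>f \<in> H\<close> \<open>f \<in> H'\<close> by blast+
  then show False using assms(3) by blast
qed

text \<open>A set \<open>F\<close> that no outside edge meets contains everything reachable from any
  of its members, hence the whole component.\<close>

lemma conn_edges_component:
  assumes "H \<in> colour_components E c"
  shows "conn_edges H"
  unfolding conn_edges_def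
proof (intro allI impI, rule ccontr)
  fix F assume F: "F \<subseteq> H" "F \<noteq> {}" "F \<noteq> H" and n: "\<not> (\<exists>e\<in>H - F. \<exists>f\<in>F. e \<inter> f \<noteq> {})"
  obtain e where e: "e \<in> E" "H = (adj_same_colour E c)\<^sup>* `` {e}"
    using assms unfolding colour_components_def by blast
  obtain f where f: "f \<in> F" using F by blast
  then have "(e, f) \<in> (adj_same_colour E c)\<^sup>*" using F e by blast
  then have Hf: "H = (adj_same_colour E c)\<^sup>* `` {f}" using component_eq e by blast
  have "g \<in> F" if "(f, g) \<in> (adj_same_colour E c)\<^sup>*" for g
    using that
  proof (induction rule: rtrancl_induct)
    case (step g h)
    have "(f, h) \<in> (adj_same_colour E c)\<^sup>*" using step(1,2) by (rule rtrancl_into_rtrancl)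
    then have "h \<in> H" unfolding Hf by blast
    moreover have "h \<inter> g \<noteq> {}" using step(2) unfolding adj_same_colour_def by blast
    ultimately show ?case using n step by blast
  qed (use f in simp)
  then show False using F Hf by blast
qed

lemma mono_path_in_component:
  assumes "is_path E P u v" "monochromatic c P"
  shows "\<exists>H\<in>colour_components E c. is_path H P u v"
proof -
  let ?R = "(adj_same_colour E c)\<^sup>*"
  have P: "2 \<le> length P" "\<And>i. Suc i < length P \<Longrightarrow> {P ! i, P ! Suc i} \<in> E"
    using assms(1) unfolding is_path_def by auto
  obtain col where col: "\<And>i. Suc i < length P \<Longrightarrow> c {P ! i, P ! Suc i} = col"
    using assms(2) unfolding monochromatic_def by blast
  let ?e = "{P ! 0, P ! Suc 0}"
  have "(?e, {P ! i, P ! Suc i}) \<in> ?R" if "Suc i < length P" for i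
    using that
  proof (induction i)
    case (Suc i)
    have "({P ! i, P ! Suc i}, {P ! Suc i, P ! Suc (Suc i)}) \<in> adj_same_colour E c"
      unfolding adj_same_colour_def using Suc.prems P(2)[of i] P(2)[of "Suc i"] col[of i] col[of "Suc i"]
      by simp
    then show ?case using Suc.IH Suc.prems by (meson Suc_lessD rtrancl.rtrancl_into_rtrancl)
  qed simp
  then have "is_path (?R `` {?e}) P u v" using assms(1) unfolding is_path_def by blast
  moreover have "?R `` {?e} \<in> colour_components E c"
    unfolding colour_components_def using P by auto
  ultimately show ?thesis by blast
qed

text \<open>Sending a component to the colour of a chosen edge in it is onto the colours
  used.\<close>

lemma card_colours_le_components:
  assumes "finite E"
  shows "card (c ` E) \<le> card (colour_components E c)"
proof (rule surj_card_le)
  show "finite (colour_components E c)" unfolding colour_components_def using assms by simp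
  show "c ` E \<subseteq> (\<lambda>H. c (SOME e. e \<in> H)) ` colour_components E c"
  proof
    fix x assume "x \<in> c ` E"
    then obtain e where e: "e \<in> E" "x = c e" by blast
    let ?H = "(adj_same_colour E c)\<^sup>* `` {e}"
    have "e \<in> ?H" by blast
    then have "(SOME e. e \<in> ?H) \<in> ?H" by (rule someI)
    then have "c (SOME e. e \<in> ?H) = c e" using adj_same_colour_rtrancl[OF _ e(1)] by blast
    then show "x \<in> (\<lambda>H. c (SOME e. e \<in> H)) ` colour_components E c"
      unfolding colour_components_def using e by (metis imageI)
  qed
qed

lemma mono_bipartite_components:
  assumes "2 \<le> k" "mono_k_connected (Kbip_V s t) (Kbip_E s t) k c"
  shows "mono_bipartite (Inl ` {..<s}) (Inr ` {..<t}) (colour_components (Kbip_E s t) c) k"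
proof
  show "\<Union>(colour_components (Kbip_E s t) c) = {{x, y} |x y. x \<in> Inl ` {..<s} \<and> y \<in> Inr ` {..<t}}"
    unfolding Union_colour_components Kbip_E_def by auto
  show "{} \<notin> colour_components (Kbip_E s t) c" unfolding colour_components_def by auto
  show "\<exists>Ps. linkage (colour_components (Kbip_E s t) c) k u v Ps"
    if uv: "u \<in> Inl ` {..<s} \<union> Inr ` {..<t}" "v \<in> Inl ` {..<s} \<union> Inr ` {..<t}" "u \<noteq> v" for u v
  proof -
    have "\<exists>Ps. length Ps = k \<and> distinct Ps \<and>
              (\<forall>P\<in>set Ps. is_path (Kbip_E s t) P u v \<and> monochromatic c P) \<and>
              (\<forall>i<k. \<forall>j<k. i \<noteq> j \<longrightarrow> interior (Ps ! i) \<inter> interior (Ps ! j) = {})"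
      using assms(2) uv unfolding mono_k_connected_def Kbip_V_def by blast
    then show ?thesis unfolding linkage_def using mono_path_in_component by metis
  qed
qed (auto simp: assms(1) conn_edges_component dest: colour_components_disjoint)

section \<open>Upper bounds for \<open>mcK\<close>\<close>

lemma finite_Kbip_E: "finite (Kbip_E s t)"
proof -
  have "Kbip_E s t = (\<lambda>(i, j). {Inl i, Inr j}) ` ({..<s} \<times> {..<t})" unfolding Kbip_E_def by auto
  then show ?thesis by simp
qed

lemma colours_le:
  assumes "2 \<le> k" "mono_k_connected (Kbip_V s t) (Kbip_E s t) k c"
    and "\<And>C :: (nat + nat) set set set. mono_bipartite (Inl ` {..<s}) (Inr ` {..<t}) C k \<Longrightarrow>
      b \<le> mono_bipartite.weight C"
  shows "int (card (c ` Kbip_E s t)) \<le> int (s * t) - b"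
proof -
  interpret mono_bipartite "Inl ` {..<s}" "Inr ` {..<t}" "colour_components (Kbip_E s t) c" k
    by (rule mono_bipartite_components[OF assms(1,2)])
  have "b \<le> weight" by (rule assms(3)) unfold_locales
  then show ?thesis using weight_eq card_colours_le_components[OF finite_Kbip_E[of s t], of c]
    by (simp add: card_image)
qed

lemma finite_mc_set:
  "finite {card (c ` Kbip_E s t) |c :: (nat + nat) set \<Rightarrow> nat. mono_k_connected (Kbip_V s t) (Kbip_E s t) k c}"
  by (rule finite_subset[of _ "{..card (Kbip_E s t)}"]) (auto intro: card_image_le finite_Kbip_E)

lemma mcK_ge:
  assumes "mono_k_connected (Kbip_V s t) (Kbip_E s t) k (c :: (nat + nat) set \<Rightarrow> nat)"
  shows "card (c ` Kbip_E s t) \<le> mcK s t k"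
  unfolding mcK_def mc_def by (rule Max_ge[OF finite_mc_set]) (use assms in blast)

text \<open>The existence of a colouring makes the set under \<open>Max\<close> non-empty, so that
  the maximum is attained by some colouring.\<close>

lemma mcK_le:
  assumes "2 \<le> k" "\<exists>c :: (nat + nat) set \<Rightarrow> nat. mono_k_connected (Kbip_V s t) (Kbip_E s t) k c"
    and "\<And>C :: (nat + nat) set set set. mono_bipartite (Inl ` {..<s}) (Inr ` {..<t}) C k \<Longrightarrow>
      b \<le> mono_bipartite.weight C"
  shows "int (mcK s t k) \<le> int (s * t) - b"
proof -
  have "mcK s t k \<in> {card (c ` Kbip_E s t) |c :: (nat + nat) set \<Rightarrow> nat.
      mono_k_connected (Kbip_V s t) (Kbip_E s t) k c}"
    unfolding mcK_def mc_def by (rule Max_in[OF finite_mc_set]) (use assms(2) in blast)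
  then show ?thesis using colours_le[OF assms(1) _ assms(3)] by auto
qed

text \<open>Stronger by one than the bound in the theorem.\<close>

lemma mcK_le_half:
  assumes "2 \<le> k" "k \<le> s" "s \<le> t"
    and "\<exists>c :: (nat + nat) set \<Rightarrow> nat. mono_k_connected (Kbip_V s t) (Kbip_E s t) k c"
  shows "int (mcK s t k) \<le> int (s * t) - \<lceil>real (k * t) / 2\<rceil>"
proof (rule mcK_le[OF assms(1,4)])
  fix C :: "(nat + nat) set set set" assume "mono_bipartite (Inl ` {..<s}) (Inr ` {..<t}) C k"
  then interpret mono_bipartite "Inl ` {..<s}" "Inr ` {..<t}" C k .
  have "int k * int t \<le> 2 * weight" using weight_ge_half assms by (simp add: card_image)
  then have "real_of_int (int k * int t) \<le> real_of_int (2 * weight)" by (rule of_int_le_iff[THEN iffD2])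
  then show "\<lceil>real (k * t) / 2\<rceil> \<le> weight" by (simp add: ceiling_le_iff)
qed

lemma mcK_le_exact:
  assumes "2 \<le> k" "k \<le> s" "s \<le> t"
    and "\<exists>c :: (nat + nat) set \<Rightarrow> nat. mono_k_connected (Kbip_V s t) (Kbip_E s t) k c"
    and "s = k \<or> k \<le> 3 \<or> s = t \<and> k \<le> 5"
  shows "int (mcK s t k) \<le> int (s * t) - int (k * t) + 1"
proof -
  have "int (mcK s t k) \<le> int (s * t) - (int k * int t - 1)"
  proof (rule mcK_le[OF assms(1,4)])
    fix C :: "(nat + nat) set set set" assume "mono_bipartite (Inl ` {..<s}) (Inr ` {..<t}) C k"
    then interpret mono_bipartite "Inl ` {..<s}" "Inr ` {..<t}" C k .
    have cards: "card (Inl ` {..<s} :: (nat + nat) set) = s" "card (Inr ` {..<t} :: (nat + nat) set) = t"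
      by (simp_all add: card_image)
    show "int k * int t - 1 \<le> weight"
    \<comment> \<open>This also settles \<open>k = s = t\<close>, so that the balanced case below
      has \<open>k < t\<close>.\<close>
    proof (cases "s = k")
      case True
      then have "\<And>H H'. H \<in> C \<Longrightarrow> H' \<in> C \<Longrightarrow> H = H'" using single_class cards assms by simp
      then have "card C \<le> 1" using finC card_le_Suc0_iff_eq[of C] by simp
      then show ?thesis using weight_eq cards True by simp
    next
      case False
      show ?thesis
      proof (cases "k \<le> 3")
        case True
        show ?thesis
        proof (cases "2 \<le> card covering")
          case c: True
          have "int k * (int t - 1) + 2 \<le> weight" using weight_ge_two_covering[OF c] cards assms by simp
          \<comment> \<open>\<open>k (t - 1) + 2 \<ge> k t - 1\<close> is the condition
            \<open>k \<le> 3\<close>.\<close>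
          then show ?thesis using True by (simp add: algebra_simps)
        next
          case False
          then show ?thesis using weight_ge_covering cards assms by simp
        qed
      next
        case k3: False
        then show ?thesis using weight_ge_balanced_small cards assms False by simp
      qed
    qed
  qed
  then show ?thesis by simp
qed

lemma mcK_le_balanced:
  assumes "2 \<le> k" "k \<le> t"
    and "\<exists>c :: (nat + nat) set \<Rightarrow> nat. mono_k_connected (Kbip_V t t) (Kbip_E t t) k c"
  shows "int (mcK t t k) \<le> int (t * t) - \<lceil>(real k - 1 / 2) * real t\<rceil> + 1"
proof -
  have "int (mcK t t k) \<le> int (t * t) - (\<lceil>(real k - 1 / 2) * real t\<rceil> - 1)"
  proof (rule mcK_le[OF assms(1,3)])
    fix C :: "(nat + nat) set set set" assume "mono_bipartite (Inl ` {..<t}) (Inr ` {..<t}) C k"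
    then interpret mono_bipartite "Inl ` {..<t}" "Inr ` {..<t}" C k .
    have "2 * (int k * int t) - int t \<le> 2 * weight + 1"
      using weight_ge_balanced assms by (simp add: card_image)
    then have "real_of_int (2 * (int k * int t) - int t) \<le> real_of_int (2 * weight + 1)"
      by (rule of_int_le_iff[THEN iffD2])
    then have "(real k - 1 / 2) * real t \<le> real_of_int (weight + 1)" by (simp add: algebra_simps)
    then have "\<lceil>(real k - 1 / 2) * real t\<rceil> \<le> weight + 1" by (simp add: ceiling_le_iff)
    then show "\<lceil>(real k - 1 / 2) * real t\<rceil> - 1 \<le> weight" by simp
  qed
  then show ?thesis by simp
qed

section \<open>Disjoint paths in circulant graphs\<close>

text \<open>Walks inside \<open>X\<close> instead of paths: routes compose by transitivity, and
  repetitions are cut out once and for all in \<open>reach_path\<close>.\<close>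

definition reach :: "'a set set \<Rightarrow> 'a set \<Rightarrow> 'a \<Rightarrow> 'a \<Rightarrow> bool" where
  "reach F X a b \<longleftrightarrow> (a, b) \<in> {(x, y). x \<in> X \<and> y \<in> X \<and> {x, y} \<in> F}\<^sup>*"

definition linked :: "'a set set \<Rightarrow> nat \<Rightarrow> 'a \<Rightarrow> 'a \<Rightarrow> bool" where
  "linked F n u v \<longleftrightarrow> (\<exists>Ps. linkage {F} n u v Ps)"

lemma linked_sym: "linked F n u v \<Longrightarrow> linked F n v u"
  unfolding linked_def by (metis linkage_rev)

lemma reach_refl: "reach F X a a"
  unfolding reach_def by simp

lemma reach_step: "x \<in> X \<Longrightarrow> y \<in> X \<Longrightarrow> {x, y} \<in> F \<Longrightarrow> reach F X x y"
  unfolding reach_def by auto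

lemma reach_trans: "reach F X a b \<Longrightarrow> reach F X b c \<Longrightarrow> reach F X a c"
  unfolding reach_def by (rule rtrancl_trans)

lemma reach_path:
  assumes "reach F X a b" "a \<in> X"
  shows "\<exists>P. P \<noteq> [] \<and> hd P = a \<and> last P = b \<and> distinct P \<and> set P \<subseteq> X \<and>
    successively (\<lambda>x y. {x, y} \<in> F) P"
  using assms unfolding reach_def
proof (induction rule: converse_rtrancl_induct)
  case base
  then show ?case by (intro exI[of _ "[b]"]) auto
next
  case (step a a')
  then obtain P where P: "P \<noteq> []" "hd P = a'" "last P = b" "distinct P" "set P \<subseteq> X"
    "successively (\<lambda>x y. {x, y} \<in> F) P" by auto
  show ?case
  proof (cases "a \<in> set P")
    case True
    then obtain ys zs where ys: "P = ys @ a # zs" by (metis split_list)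
    then show ?thesis using P by (intro exI[of _ "a # zs"]) (auto simp: successively_append_iff)
  next
    case False
    then show ?thesis using P step.hyps(1) step.prems
      by (intro exI[of _ "a # P"]) (auto simp: successively_Cons)
  qed
qed

lemma path_through:
  assumes "u \<noteq> v" "u \<notin> X" "v \<notin> X" "a \<in> X" "{u, a} \<in> F" "{b, v} \<in> F" "reach F X a b"
  shows "\<exists>P. is_path F P u v \<and> interior P \<subseteq> X \<and> interior P \<noteq> {}"
proof -
  obtain P where P: "P \<noteq> []" "hd P = a" "last P = b" "distinct P" "set P \<subseteq> X"
    "successively (\<lambda>x y. {x, y} \<in> F) P" using reach_path[OF assms(7,4)] by blast
  have "successively (\<lambda>x y. {x, y} \<in> F) (u # P @ [v])"
    using P assms by (simp add: successively_Cons successively_append_iff)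
  then have "is_path F (u # P @ [v]) u v"
    unfolding is_path_def using P assms by (auto simp: successively_conv_nth)
  moreover have "interior (u # P @ [v]) = set P"
    unfolding interior_def using P assms by auto
  ultimately show ?thesis using P by (metis set_empty)
qed

text \<open>One path is routed through each of the disjoint sets \<open>X i\<close>, so disjointness
  is checked on sets, not on paths. The second conclusion adds the edge \<open>{u, v}\<close> as a
  further path.\<close>

lemma linked_through_sets:
  assumes "finite I" "u \<noteq> v"
    and disj: "\<And>i j. i \<in> I \<Longrightarrow> j \<in> I \<Longrightarrow> i \<noteq> j \<Longrightarrow> X i \<inter> X j = {}"
    and ends: "\<And>i. i \<in> I \<Longrightarrow> u \<notin> X i \<and> v \<notin> X i"
    and conn: "\<And>i. i \<in> I \<Longrightarrow> \<exists>a\<in>X i. \<exists>b. {u, a} \<in> F \<and> {b, v} \<in> F \<and> reach F (X i) a b"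
  shows "linked F (card I) u v" and "{u, v} \<in> F \<Longrightarrow> linked F (Suc (card I)) u v"
proof -
  have "\<exists>P. is_path F P u v \<and> interior P \<subseteq> X i \<and> interior P \<noteq> {}" if i: "i \<in> I" for i
    using conn[OF i] ends[OF i] path_through[OF assms(2), of "X i"] by blast
  then obtain P where P: "\<And>i. i \<in> I \<Longrightarrow> is_path F (P i) u v"
    "\<And>i. i \<in> I \<Longrightarrow> interior (P i) \<subseteq> X i" "\<And>i. i \<in> I \<Longrightarrow> interior (P i) \<noteq> {}" by metis
  obtain xs where xs: "set xs = I" "distinct xs" using finite_distinct_list[OF assms(1)] by blast
  then have len: "length xs = card I" using distinct_card by force
  define Ps where "Ps = map P xs"
  have dj: "interior (P i) \<inter> interior (P j) = {}" if "i \<in> I" "j \<in> I" "i \<noteq> j" for i j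
    using disj[OF that] P(2)[OF that(1)] P(2)[OF that(2)] by blast
  \<comment> \<open>Interiors that are disjoint and non-empty belong to different paths.\<close>
  have "inj_on P I" by (rule inj_onI, rule ccontr) (use dj P(3) in force)
  then have dist: "distinct Ps" unfolding Ps_def using xs by (simp add: distinct_map)
  have dP: "interior (Ps ! i) \<inter> interior (Ps ! j) = {}"
    if "i < card I" "j < card I" "i \<noteq> j" for i j
  proof -
    have "xs ! i \<in> I" "xs ! j \<in> I" "xs ! i \<noteq> xs ! j"
      using that len xs nth_mem[of i xs] nth_mem[of j xs] by (auto simp: nth_eq_iff_index_eq)
    then show ?thesis using dj that len unfolding Ps_def by simp
  qed
  have lenP: "length Ps = card I" unfolding Ps_def using len by simp
  have isP: "\<forall>Q\<in>set Ps. is_path F Q u v" unfolding Ps_def using P(1) xs by auto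
  show "linked F (card I) u v"
    unfolding linked_def linkage_def using dist dP lenP isP by blast
  assume uv: "{u, v} \<in> F"
  have "is_path F [u, v] u v" unfolding is_path_def using uv assms(2) by auto
  moreover have i0: "interior [u, v] = {}" unfolding interior_def by auto
  moreover have "[u, v] \<notin> set Ps" unfolding Ps_def using P(3) xs i0 by fastforce
  moreover have "interior (([u, v] # Ps) ! i) \<inter> interior (([u, v] # Ps) ! j) = {}"
    if "i < Suc (card I)" "j < Suc (card I)" "i \<noteq> j" for i j
    using that dP i0 by (cases i; cases j) auto
  ultimately have "linkage {F} (Suc (card I)) u v ([u, v] # Ps)"
    unfolding linkage_def using dist lenP isP by simp
  then show "linked F (Suc (card I)) u v" unfolding linked_def by blast
qed

text \<open>\<open>L\<close> and \<open>R\<close> enumerate one side each with period \<open>s\<close>. They are parameters so that translation,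
  reflection, exchange of the sides and the choice of representatives of twin vertices are instances.\<close>

locale circulant =
  fixes L R :: "int \<Rightarrow> 'a" and F :: "'a set set" and s k :: int
  assumes k2: "2 \<le> k" and ks: "k \<le> s"
    and perL: "L (i + s) = L i" and perR: "R (i + s) = R i"
    and injL: "L i = L j \<Longrightarrow> \<bar>i - j\<bar> < s \<Longrightarrow> i = j"
    and injR: "R i = R j \<Longrightarrow> \<bar>i - j\<bar> < s \<Longrightarrow> i = j"
    and LR: "L i \<noteq> R j"
    and adj: "j \<le> i \<Longrightarrow> i \<le> j + k - 1 \<Longrightarrow> {L i, R j} \<in> F"
begin

section \<open>Symmetries and index windows of a circulant\<close>

lemma adj': "j \<le> i \<Longrightarrow> i \<le> j + k - 1 \<Longrightarrow> {R j, L i} \<in> F"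
  using adj by (simp add: insert_commute)

lemma shift: "circulant (\<lambda>x. L (x + d)) (\<lambda>x. R (x + d)) F s k"
proof
  show "L (i + s + d) = L (i + d)" for i using perL[of "i + d"] by (simp add: algebra_simps)
  show "R (i + s + d) = R (i + d)" for i using perR[of "i + d"] by (simp add: algebra_simps)
  show "i = j" if "L (i + d) = L (j + d)" "\<bar>i - j\<bar> < s" for i j using injL[OF that(1)] that(2) by simp
  show "i = j" if "R (i + d) = R (j + d)" "\<bar>i - j\<bar> < s" for i j using injR[OF that(1)] that(2) by simp
  show "{L (i + d), R (j + d)} \<in> F" if "j \<le> i" "i \<le> j + k - 1" for i j using adj that by simp
qed (use k2 ks LR in auto)

text \<open>Fixes \<open>R 0\<close> and reverses its interval of neighbours
  \<open>L 0, ..., L (k - 1)\<close>, so that the pair \<open>R 0, L (k - 1)\<close> reduces to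
  \<open>R 0, L 0\<close>.\<close>

lemma reflect: "circulant (\<lambda>x. L (k - 1 - x)) (\<lambda>x. R (- x)) F s k"
proof
  show "L (k - 1 - (i + s)) = L (k - 1 - i)" for i using perL[of "k - 1 - (i + s)"] by (simp add: algebra_simps)
  show "R (- (i + s)) = R (- i)" for i using perR[of "- (i + s)"] by simp
  show "i = j" if "L (k - 1 - i) = L (k - 1 - j)" "\<bar>i - j\<bar> < s" for i j
    using injL[OF that(1)] that(2) by simp
  show "i = j" if "R (- i) = R (- j)" "\<bar>i - j\<bar> < s" for i j using injR[OF that(1)] that(2) by simp
  show "{L (k - 1 - i), R (- j)} \<in> F" if "j \<le> i" "i \<le> j + k - 1" for i j using adj that by simp
qed (use k2 ks LR in auto)

lemma swap: "circulant (\<lambda>x. R (- x)) (\<lambda>x. L (- x)) F s k"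
proof
  show "L (- (i + s)) = L (- i)" for i using perL[of "- (i + s)"] by simp
  show "R (- (i + s)) = R (- i)" for i using perR[of "- (i + s)"] by simp
  show "i = j" if "L (- i) = L (- j)" "\<bar>i - j\<bar> < s" for i j using injL[OF that(1)] that(2) by simp
  show "i = j" if "R (- i) = R (- j)" "\<bar>i - j\<bar> < s" for i j using injR[OF that(1)] that(2) by simp
  show "{R (- i), L (- j)} \<in> F" if "j \<le> i" "i \<le> j + k - 1" for i j using adj' that by simp
  show "R (- i) \<noteq> L (- j)" for i j using LR by metis
qed (use k2 ks in auto)

text \<open>Inside a window of length \<open>s\<close> distinct indices name distinct vertices. The
  two sides have separate windows because some constructions use negative indices on one side
  only.\<close>

lemma windows_disjoint:
  assumes "P \<subseteq> {p..<p + s}" "P' \<subseteq> {p..<p + s}" "Q \<subseteq> {q..<q + s}" "Q' \<subseteq> {q..<q + s}"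
    and "P \<inter> P' = {}" "Q \<inter> Q' = {}"
  shows "(L ` P \<union> R ` Q) \<inter> (L ` P' \<union> R ` Q') = {}"
proof -
  have "L i \<noteq> L j" if "i \<in> P" "j \<in> P'" for i j
  proof
    assume "L i = L j"
    moreover have "i \<in> {p..<p + s}" "j \<in> {p..<p + s}" using that assms by blast+
    ultimately have "i = j" using injL[of i j] by auto
    then show False using that assms(5) by blast
  qed
  moreover have "R i \<noteq> R j" if "i \<in> Q" "j \<in> Q'" for i j
  proof
    assume "R i = R j"
    moreover have "i \<in> {q..<q + s}" "j \<in> {q..<q + s}" using that assms by blast+
    ultimately have "i = j" using injR[of i j] by auto
    then show False using that assms(6) by blast
  qed
  moreover have "L i \<noteq> R j" "R j \<noteq> L i" for i j using LR[of i j] by auto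
  ultimately show ?thesis by blast
qed

lemma linked_RR_windows:
  assumes I: "finite I"
    and P: "\<And>a. a \<in> I \<Longrightarrow> P a \<subseteq> {p..<p + s}" and Q: "\<And>a. a \<in> I \<Longrightarrow> Q a \<subseteq> {q..<q + s}"
    and PP: "\<And>a b. a \<in> I \<Longrightarrow> b \<in> I \<Longrightarrow> a \<noteq> b \<Longrightarrow> P a \<inter> P b = {}"
    and QQ: "\<And>a b. a \<in> I \<Longrightarrow> b \<in> I \<Longrightarrow> a \<noteq> b \<Longrightarrow> Q a \<inter> Q b = {}"
    and uv: "u \<in> {q..<q + s}" "v \<in> {q..<q + s}" "u \<noteq> v" "\<And>a. a \<in> I \<Longrightarrow> u \<notin> Q a \<and> v \<notin> Q a"
    and path: "\<And>a. a \<in> I \<Longrightarrow> \<exists>x\<in>P a. \<exists>y. {R u, L x} \<in> F \<and> {L y, R v} \<in> F \<and>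
      reach F (L ` P a \<union> R ` Q a) (L x) (L y)"
  shows "linked F (card I) (R u) (R v)"
proof (rule linked_through_sets(1)[OF I])
  have "\<bar>u - v\<bar> < s" using uv(1,2) by (simp add: abs_less_iff)
  then show "R u \<noteq> R v" using injR[of u v] uv(3) by blast
  show "(L ` P a \<union> R ` Q a) \<inter> (L ` P b \<union> R ` Q b) = {}" if "a \<in> I" "b \<in> I" "a \<noteq> b" for a b
    using that by (intro windows_disjoint[of _ p _ _ q] P Q PP QQ) auto
  show "R u \<notin> L ` P a \<union> R ` Q a \<and> R v \<notin> L ` P a \<union> R ` Q a" if a: "a \<in> I" for a
    using windows_disjoint[of "P a" p "{}" "Q a" q "{u, v}"] P[OF a] Q[OF a] uv(1-3) uv(4)[OF a] by auto
  show "\<exists>x\<in>L ` P a \<union> R ` Q a. \<exists>y. {R u, x} \<in> F \<and> {y, R v} \<in> F \<and> reach F (L ` P a \<union> R ` Q a) x y"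
    if a: "a \<in> I" for a using path[OF a] by blast
qed

lemma linked_RL_windows:
  assumes I: "finite I"
    and P: "\<And>a. a \<in> I \<Longrightarrow> P a \<subseteq> {p..<p + s}" and Q: "\<And>a. a \<in> I \<Longrightarrow> Q a \<subseteq> {q..<q + s}"
    and PP: "\<And>a b. a \<in> I \<Longrightarrow> b \<in> I \<Longrightarrow> a \<noteq> b \<Longrightarrow> P a \<inter> P b = {}"
    and QQ: "\<And>a b. a \<in> I \<Longrightarrow> b \<in> I \<Longrightarrow> a \<noteq> b \<Longrightarrow> Q a \<inter> Q b = {}"
    and uv: "u \<in> {q..<q + s}" "v \<in> {p..<p + s}" "\<And>a. a \<in> I \<Longrightarrow> u \<notin> Q a \<and> v \<notin> P a"
    and path: "\<And>a. a \<in> I \<Longrightarrow> \<exists>x\<in>P a. \<exists>y. {R u, L x} \<in> F \<and> {R y, L v} \<in> F \<and>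
      reach F (L ` P a \<union> R ` Q a) (L x) (R y)"
  shows "linked F (card I) (R u) (L v)" and "{R u, L v} \<in> F \<Longrightarrow> linked F (Suc (card I)) (R u) (L v)"
proof -
  have 1: "R u \<noteq> L v" using LR by metis
  have 2: "(L ` P a \<union> R ` Q a) \<inter> (L ` P b \<union> R ` Q b) = {}" if "a \<in> I" "b \<in> I" "a \<noteq> b" for a b
    using that by (intro windows_disjoint[of _ p _ _ q] P Q PP QQ) auto
  have 3: "R u \<notin> L ` P a \<union> R ` Q a \<and> L v \<notin> L ` P a \<union> R ` Q a" if a: "a \<in> I" for a
    using windows_disjoint[of "P a" p "{v}" "Q a" q "{u}"] P[OF a] Q[OF a] uv(1-2) uv(3)[OF a] by auto
  have 4: "\<exists>x\<in>L ` P a \<union> R ` Q a. \<exists>y. {R u, x} \<in> F \<and> {y, L v} \<in> F \<and> reach F (L ` P a \<union> R ` Q a) x y"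
    if a: "a \<in> I" for a using path[OF a] by blast
  note * = linked_through_sets[OF I 1, of "\<lambda>a. L ` P a \<union> R ` Q a" F]
  show "linked F (card I) (R u) (L v)" using *(1) 2 3 4 by blast
  show "linked F (Suc (card I)) (R u) (L v)" if "{R u, L v} \<in> F" using *(2) 2 3 4 that by blast
qed

section \<open>Routes and explicit path systems\<close>

lemma reach_jumps:
  assumes "\<And>i. i \<le> n \<Longrightarrow> a + int i * (k - 1) \<in> P" "\<And>i. i < n \<Longrightarrow> a + int i * (k - 1) \<in> Q"
  shows "reach F (L ` P \<union> R ` Q) (L a) (L (a + int n * (k - 1)))"
  using assms
proof (induction n)
  case 0
  then show ?case by (simp add: reach_refl)
next
  case (Suc n)
  let ?j = "a + int n * (k - 1)"
  have j: "?j \<in> P" "?j \<in> Q" "?j + (k - 1) \<in> P"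
    using Suc.prems(1)[of n] Suc.prems(2)[of n] Suc.prems(1)[of "Suc n"] by (auto simp: algebra_simps)
  have "reach F (L ` P \<union> R ` Q) (L a) (L ?j)" using Suc by simp
  \<comment> \<open>A jump passes through \<open>R ?j\<close>, whose extreme neighbours are
    \<open>L ?j\<close> and \<open>L (?j + k - 1)\<close>.\<close>
  moreover have "reach F (L ` P \<union> R ` Q) (L ?j) (R ?j)" using j k2 by (intro reach_step adj) auto
  moreover have "reach F (L ` P \<union> R ` Q) (R ?j) (L (?j + (k - 1)))" using j k2 by (intro reach_step adj') auto
  moreover have "?j + (k - 1) = a + int (Suc n) * (k - 1)" by (simp add: algebra_simps)
  ultimately show ?case by (metis reach_trans)
qed

lemma reach_down:
  assumes "x \<le> y" "{x..y} \<subseteq> P" "{x..<y} \<subseteq> Q"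
  shows "reach F (L ` P \<union> R ` Q) (L y) (L x)"
  using assms
proof (induction y rule: int_ge_induct)
  case base
  then show ?case by (simp add: reach_refl)
next
  case (step y)
  have "y + 1 \<in> P" "y \<in> P" "y \<in> Q" using step by auto
  then have "reach F (L ` P \<union> R ` Q) (L (y + 1)) (R y)" "reach F (L ` P \<union> R ` Q) (R y) (L y)"
    using k2 by (auto intro!: reach_step adj adj')
  moreover have "{x..y} \<subseteq> P" "{x..<y} \<subseteq> Q" using step.prems by auto
  ultimately show ?case using step.IH reach_trans by metis
qed

lemma reach_up:
  assumes "x \<le> y" "{x..y} \<subseteq> P" "{x..<y} \<subseteq> Q"
  shows "reach F (L ` P \<union> R ` Q) (L x) (L y)"
  using assms
proof (induction y rule: int_ge_induct)
  case base
  then show ?case by (simp add: reach_refl)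
next
  case (step y)
  have "y + 1 \<in> P" "y \<in> P" "y \<in> Q" using step by auto
  then have "reach F (L ` P \<union> R ` Q) (L y) (R y)" "reach F (L ` P \<union> R ` Q) (R y) (L (y + 1))"
    using k2 by (auto intro!: reach_step adj adj')
  moreover have "{x..y} \<subseteq> P" "{x..<y} \<subseteq> Q" using step.prems by auto
  ultimately show ?case using step.IH reach_trans by metis
qed

lemma least_jump:
  obtains n where "d \<le> a + int n * (k - 1)" "\<And>i. i < n \<Longrightarrow> a + int i * (k - 1) < d"
proof -
  have "d \<le> a + int (nat (d - a)) * (k - 1)"
  proof (cases "a \<le> d")
    case True
    have "(d - a) * 1 \<le> (d - a) * (k - 1)" using True k2 by (intro mult_left_mono) auto
    then show ?thesis using True by simp
  qed simp
  then have "\<exists>n. d \<le> a + int n * (k - 1)" by blast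
  then show ?thesis using that exists_least_iff[of "\<lambda>n. d \<le> a + int n * (k - 1)"] by (meson not_le)
qed

lemma mod_eq_small:
  assumes "a mod m = b mod m" "1 \<le> a" "a \<le> m" "1 \<le> b" "b \<le> (m :: int)"
  shows "a = b"
proof -
  have "m dvd a - b" using assms(1) by (metis mod_eq_dvd_iff)
  moreover have "\<bar>a - b\<bar> < m" using assms by linarith
  ultimately show ?thesis using zdvd_imp_le[of m "\<bar>a - b\<bar>"] by fastforce
qed

text \<open>The neighbours \<open>L 1, \<dots>, L (k - 1)\<close> of \<open>R 0\<close> start \<open>k - 1\<close> paths which jump forward in steps of
  \<open>k - 1\<close>, one in each residue class; the neighbour \<open>L 0 = L s\<close> starts a path going down in unit steps.\<close>

lemma linked_RR_far:
  assumes "0 < d" "d + k - 1 \<le> s"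
  shows "linked F (nat k) (R 0) (R d)"
proof -
  define m where "m = k - 1"
  have m: "1 \<le> m" "k = m + 1" using k2 unfolding m_def by auto
  \<comment> \<open>The neighbours of \<open>R d\<close> are \<open>L d, ..., L (d + m)\<close>. The
    jumping paths end at the first index that is at least \<open>d\<close>, which is below
    \<open>d + m\<close>; the descending path keeps to the indices from \<open>d + m\<close> to
    \<open>s\<close> and ends at \<open>L (d + m)\<close>.\<close>
  define P where "P a = (if a = 0 then {d + m..s} else {j. 1 \<le> j \<and> j < d + m \<and> j mod m = a mod m})" for a
  define Q where "Q a = (if a = 0 then {d + m..<s} else {j. 1 \<le> j \<and> j < d \<and> j mod m = a mod m})" for a
  have "linked F (card {0..k - 1}) (R 0) (R d)"
  proof (rule linked_RR_windows[of _ P 1 Q 0])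
    fix a assume a: "a \<in> {0..k - 1}"
    show "P a \<subseteq> {1..<1 + s}" "Q a \<subseteq> {0..<0 + s}" unfolding P_def Q_def using assms m by auto
    show "0 \<notin> Q a \<and> d \<notin> Q a" unfolding Q_def using assms m by auto
    show "\<exists>x\<in>P a. \<exists>y. {R 0, L x} \<in> F \<and> {L y, R d} \<in> F \<and> reach F (L ` P a \<union> R ` Q a) (L x) (L y)"
    proof (cases "a = 0")
      case True
      have "{R 0, L s} \<in> F" using adj'[of 0 0] perL[of 0] k2 by simp
      moreover have "{L (d + m), R d} \<in> F" using m by (intro adj) auto
      moreover have "reach F (L ` P a \<union> R ` Q a) (L s) (L (d + m))"
        using True assms m unfolding P_def Q_def by (intro reach_down) auto
      moreover have "s \<in> P a" using True assms m unfolding P_def by auto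
      ultimately show ?thesis by blast
    next
      case False
      then have a1: "1 \<le> a" "a \<le> m" using a m by auto
      obtain n where n: "d \<le> a + int n * (k - 1)" "\<And>i. i < n \<Longrightarrow> a + int i * (k - 1) < d"
        using least_jump by blast
      have nm: "0 \<le> int i * m" for i using m by simp
      have lt: "a + int n * m < d + m"
      proof (cases n)
        case 0
        then show ?thesis using a1 assms by simp
      next
        case (Suc n')
        then show ?thesis using n(2)[of n'] m by (simp add: algebra_simps)
      qed
      have inP: "a + int i * (k - 1) \<in> P a" if "i \<le> n" for i
      proof -
        have "int i * m \<le> int n * m" using that m by (intro mult_right_mono) auto
        then have "1 \<le> a + int i * m" "a + int i * m < d + m" using a1 nm[of i] lt by linarith+
        then show ?thesis unfolding P_def using False m(2) by simp
      qed
      have inQ: "a + int i * (k - 1) \<in> Q a" if "i < n" for i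
      proof -
        have "1 \<le> a + int i * m" using a1 nm[of i] by linarith
        then show ?thesis unfolding Q_def using False n(2)[OF that] m(2) by simp
      qed
      have "{R 0, L a} \<in> F" using a1 m by (intro adj') auto
      moreover have "{L (a + int n * (k - 1)), R d} \<in> F" using n(1) lt m by (intro adj) auto
      moreover have "a \<in> P a" using inP[of 0] by simp
      ultimately show ?thesis using reach_jumps[OF inP inQ] by blast
    qed
  next
    fix a b assume ab: "a \<in> {0..k - 1}" "b \<in> {0..k - 1}" "a \<noteq> b"
    have "a mod m \<noteq> b mod m" if "a \<noteq> 0" "b \<noteq> 0" using mod_eq_small[of a m b] ab that m by auto
    then show "P a \<inter> P b = {}" "Q a \<inter> Q b = {}" unfolding P_def Q_def using ab m by auto
  qed (use assms k2 in auto)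
  then show ?thesis by simp
qed

text \<open>Here the neighbourhoods of \<open>R 0\<close> and \<open>R d\<close> overlap at both
  ends of the cycle; \<open>near\<close> marks the common neighbours, which give paths of length 2.
  Adding \<open>s - d\<close> maps the remaining neighbours \<open>L a\<close> of \<open>R 0\<close>
  onto those of \<open>R d\<close>, and \<open>R a\<close> is adjacent to both \<open>L a\<close>
  and \<open>L (a + s - d)\<close>.\<close>

lemma linked_RR_dense:
  assumes "0 < d" "d < k - 1" "s < d + k - 1"
  shows "linked F (nat k) (R 0) (R d)"
proof -
  define near where "near a \<longleftrightarrow> d \<le> a \<or> a \<le> d + k - 1 - s" for a
  define P where "P a = (if near a then {a} else {a, a + s - d})" for a
  define Q where "Q a = (if near a then {} else {a})" for a
  have "linked F (card {0..k - 1}) (R 0) (R d)"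
  proof (rule linked_RR_windows[of _ P 0 Q 0])
    fix a assume a: "a \<in> {0..k - 1}"
    show "P a \<subseteq> {0..<0 + s}" "Q a \<subseteq> {0..<0 + s}"
      unfolding P_def Q_def near_def using assms ks a by auto
    show "0 \<notin> Q a \<and> d \<notin> Q a" unfolding Q_def near_def using assms by auto
    have Fa: "{R 0, L a} \<in> F" using a by (intro adj') auto
    show "\<exists>x\<in>P a. \<exists>y. {R 0, L x} \<in> F \<and> {L y, R d} \<in> F \<and> reach F (L ` P a \<union> R ` Q a) (L x) (L y)"
    proof (cases "near a")
      case True
      have "{L a, R d} \<in> F"
      proof (cases "d \<le> a")
        case True
        then show ?thesis using a assms by (intro adj) auto
      next
        case False
        then have "{L (a + s), R d} \<in> F" using \<open>near a\<close> a assms ks unfolding near_def by (intro adj) auto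
        then show ?thesis using perL by simp
      qed
      then show ?thesis using Fa True reach_refl unfolding P_def by fastforce
    next
      case False
      have "{L (a + s - d), R d} \<in> F" using False a assms ks unfolding near_def by (intro adj) auto
      moreover have "reach F (L ` P a \<union> R ` Q a) (L a) (L (a + s - d))"
      proof (rule reach_trans)
        show "reach F (L ` P a \<union> R ` Q a) (L a) (R a)"
          using False k2 unfolding P_def Q_def by (intro reach_step adj) auto
        show "reach F (L ` P a \<union> R ` Q a) (R a) (L (a + s - d))"
          using False assms ks unfolding P_def Q_def by (intro reach_step adj') auto
      qed
      moreover have "a \<in> P a" unfolding P_def by auto
      ultimately show ?thesis using Fa by blast
    qed
  next
    fix a b assume ab: "a \<in> {0..k - 1}" "b \<in> {0..k - 1}" "a \<noteq> b"
    show "P a \<inter> P b = {}" "Q a \<inter> Q b = {}" unfolding P_def Q_def near_def using ab by auto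
  qed (use assms k2 ks in auto)
  then show ?thesis by simp
qed

text \<open>The scheme of \<open>linked_RR_far\<close>, ended at the neighbours
  \<open>R (e - k + 1), ..., R e\<close> of \<open>L e\<close>: the descending path enters through
  \<open>R e\<close>, the \<open>k - 1\<close> jumping paths through the others.\<close>

lemma linked_RL_far:
  assumes "k \<le> e" "e < s"
  shows "linked F (nat k) (R 0) (L e)"
proof -
  define m where "m = k - 1"
  have m: "1 \<le> m" "k = m + 1" using k2 unfolding m_def by auto
  define P where "P a = (if a = 0 then {e + 1..s} else {j. 1 \<le> j \<and> j < e \<and> j mod m = a mod m})" for a
  define Q where "Q a = (if a = 0 then {e..<s} else {j. 1 \<le> j \<and> j < e \<and> j mod m = a mod m})" for a
  have "linked F (card {0..k - 1}) (R 0) (L e)"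
  proof (rule linked_RL_windows(1)[of _ P 1 Q 0])
    fix a assume a: "a \<in> {0..k - 1}"
    show "P a \<subseteq> {1..<1 + s}" "Q a \<subseteq> {0..<0 + s}" unfolding P_def Q_def using assms m by auto
    show "0 \<notin> Q a \<and> e \<notin> P a" unfolding P_def Q_def using assms m by auto
    show "\<exists>x\<in>P a. \<exists>y. {R 0, L x} \<in> F \<and> {R y, L e} \<in> F \<and> reach F (L ` P a \<union> R ` Q a) (L x) (R y)"
    proof (cases "a = 0")
      case True
      have "{R 0, L s} \<in> F" using adj'[of 0 0] perL[of 0] k2 by simp
      moreover have "{R e, L e} \<in> F" using k2 by (intro adj') auto
      moreover have "reach F (L ` P a \<union> R ` Q a) (L s) (R e)"
      proof (rule reach_trans)
        show "reach F (L ` P a \<union> R ` Q a) (L s) (L (e + 1))"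
          using True assms m unfolding P_def Q_def by (intro reach_down) auto
        show "reach F (L ` P a \<union> R ` Q a) (L (e + 1)) (R e)"
          using True assms m unfolding P_def Q_def by (intro reach_step adj) auto
      qed
      moreover have "s \<in> P a" using True assms m unfolding P_def by auto
      ultimately show ?thesis by blast
    next
      case False
      then have a1: "1 \<le> a" "a \<le> m" using a m by auto
      obtain n where n: "e - m \<le> a + int n * (k - 1)" "\<And>i. i < n \<Longrightarrow> a + int i * (k - 1) < e - m"
        using least_jump by blast
      have nm: "0 \<le> int i * m" for i using m by simp
      have lt: "a + int n * m < e"
      proof (cases n)
        case 0
        then show ?thesis using a1 assms m by simp
      next
        case (Suc n')
        then show ?thesis using n(2)[of n'] m by (simp add: algebra_simps)
      qed
      have inPQ: "a + int i * (k - 1) \<in> P a" "a + int i * (k - 1) \<in> Q a" if "i \<le> n" for i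
      proof -
        have "int i * m \<le> int n * m" using that m by (intro mult_right_mono) auto
        then have "1 \<le> a + int i * m" "a + int i * m < e" using a1 nm[of i] lt by linarith+
        then show "a + int i * (k - 1) \<in> P a" "a + int i * (k - 1) \<in> Q a"
          unfolding P_def Q_def using False m(2) by simp_all
      qed
      let ?y = "a + int n * (k - 1)"
      have "{R 0, L a} \<in> F" using a1 m by (intro adj') auto
      moreover have "{R ?y, L e} \<in> F" using n(1) lt m by (intro adj') auto
      moreover have "reach F (L ` P a \<union> R ` Q a) (L a) (R ?y)"
      proof (rule reach_trans)
        show "reach F (L ` P a \<union> R ` Q a) (L a) (L ?y)"
          by (rule reach_jumps) (use inPQ in auto)
        show "reach F (L ` P a \<union> R ` Q a) (L ?y) (R ?y)"
          using inPQ[of n] k2 by (intro reach_step adj) auto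
      qed
      moreover have "a \<in> P a" using inPQ(1)[of 0] by simp
      ultimately show ?thesis by blast
    qed
  next
    fix a b assume ab: "a \<in> {0..k - 1}" "b \<in> {0..k - 1}" "a \<noteq> b"
    have "a mod m \<noteq> b mod m" if "a \<noteq> 0" "b \<noteq> 0" using mod_eq_small[of a m b] ab that m by auto
    then show "P a \<inter> P b = {}" "Q a \<inter> Q b = {}" unfolding P_def Q_def using ab m by auto
  qed (use assms k2 in auto)
  then show ?thesis by simp
qed

lemma linked_RL_middle:
  assumes "0 < e" "e < k - 1"
  shows "linked F (nat k) (R 0) (L e)"
proof -
  define \<rho> where "\<rho> a = (if a = 0 then e - k + 1 else if a = k - 1 then e
    else if a < e then a else a - k + 1)" for a
  let ?I = "{0..k - 1} - {e}"
  have "linked F (Suc (card ?I)) (R 0) (L e)"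
  proof (rule linked_RL_windows(2)[of _ "\<lambda>a. {a}" 0 "\<lambda>a. {\<rho> a}" "e - k + 1"])
    fix a assume a: "a \<in> ?I"
    show "{a} \<subseteq> {0..<0 + s}" using a ks by auto
    show "{\<rho> a} \<subseteq> {e - k + 1..<e - k + 1 + s}" unfolding \<rho>_def using a assms ks by auto
    show "0 \<notin> {\<rho> a} \<and> e \<notin> {a}" unfolding \<rho>_def using a assms by auto
    have "{R 0, L a} \<in> F" using a by (intro adj') auto
    moreover have "{R (\<rho> a), L e} \<in> F" unfolding \<rho>_def using a assms by (intro adj') auto
    moreover have "{L a, R (\<rho> a)} \<in> F" unfolding \<rho>_def using a assms by (intro adj) auto
    then have "reach F (L ` {a} \<union> R ` {\<rho> a}) (L a) (R (\<rho> a))" by (intro reach_step) auto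
    ultimately show "\<exists>x\<in>{a}. \<exists>y. {R 0, L x} \<in> F \<and> {R y, L e} \<in> F \<and>
        reach F (L ` {a} \<union> R ` {\<rho> a}) (L x) (R y)" by blast
  next
    fix a b assume ab: "a \<in> ?I" "b \<in> ?I" "a \<noteq> b"
    show "{a} \<inter> {b} = {}" using ab by simp
    show "{\<rho> a} \<inter> {\<rho> b} = {}" unfolding \<rho>_def using ab assms by auto
  qed (use assms k2 ks in \<open>auto intro: adj'\<close>)
  moreover have "Suc (card ?I) = nat k" using assms k2 card.remove[of "{0..k - 1}" e] by simp
  ultimately show ?thesis by simp
qed

text \<open>For \<open>a < k - 1\<close> the path goes from \<open>L a\<close> directly to
  \<open>R (a - k + 1 + s)\<close>. For \<open>a = k - 1\<close> this would be \<open>R 0\<close>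
  again, so that path moves to the one neighbour of \<open>L 0\<close> left,
  \<open>R (s - k + 1)\<close>: upwards in unit steps, or by one edge if the index does not exceed
  \<open>k - 1\<close>.\<close>

lemma linked_RL_0: "linked F (nat k) (R 0) (L 0)"
proof -
  \<comment> \<open>\<open>insert\<close> keeps the two ends of the route when the interval is
    empty.\<close>
  define P where "P a = (if a = k - 1 then insert (k - 1) {k - 1..s - k + 1} else {a})" for a
  define Q where "Q a = (if a = k - 1 then insert (s - k + 1) {k - 1..s - k + 1} else {a - k + 1 + s})" for a
  have "linked F (Suc (card {1..k - 1})) (R 0) (L 0)"
  proof (rule linked_RL_windows(2)[of _ P 0 Q 0])
    fix a assume a: "a \<in> {1..k - 1}"
    show "P a \<subseteq> {0..<0 + s}" "Q a \<subseteq> {0..<0 + s}" unfolding P_def Q_def using a ks k2 by auto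
    show "0 \<notin> Q a \<and> 0 \<notin> P a" unfolding P_def Q_def using a ks k2 by auto
    have Fa: "{R 0, L a} \<in> F" using a by (intro adj') auto
    have aP: "a \<in> P a" unfolding P_def by auto
    define y where "y = a - k + 1 + s"
    have "{R y, L s} \<in> F" unfolding y_def using a by (intro adj') auto
    then have Fy: "{R y, L 0} \<in> F" using perL[of 0] by simp
    define z where "z = (if a = k - 1 then s - k + 1 else y)"
    have Fz: "{R z, L 0} \<in> F"
    proof (cases "a = k - 1")
      case True
      have "{R z, L s} \<in> F" unfolding z_def using True k2 by (intro adj') auto
      then show ?thesis using perL[of 0] by simp
    next
      case False
      then show ?thesis using Fy z_def by simp
    qed
    have zQ: "z \<in> Q a" unfolding Q_def z_def y_def by auto
    have "reach F (L ` P a \<union> R ` Q a) (L a) (R z)"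
    proof (cases "a = k - 1")
      case True
      show ?thesis
      proof (cases "k - 1 \<le> s - k + 1")
        case le: True
        show ?thesis
        proof (rule reach_trans)
          show "reach F (L ` P a \<union> R ` Q a) (L a) (L z)"
            using True le unfolding P_def Q_def z_def by (intro reach_up) auto
          show "reach F (L ` P a \<union> R ` Q a) (L z) (R z)"
            using True le zQ k2 unfolding P_def z_def by (intro reach_step adj) auto
        qed
      next
        case False
        then show ?thesis using True aP zQ ks unfolding z_def by (intro reach_step adj) auto
      qed
    next
      case False
      have "{L (a + s), R z} \<in> F" unfolding z_def y_def using False a k2 by (intro adj) auto
      then have "{L a, R z} \<in> F" using perL by simp
      then show ?thesis using aP zQ by (intro reach_step) auto
    qed
    then show "\<exists>x\<in>P a. \<exists>y. {R 0, L x} \<in> F \<and> {R y, L 0} \<in> F \<and> reach F (L ` P a \<union> R ` Q a) (L x) (R y)"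
      using Fa aP Fz by blast
  next
    fix a b assume ab: "a \<in> {1..k - 1}" "b \<in> {1..k - 1}" "a \<noteq> b"
    show "P a \<inter> P b = {}" "Q a \<inter> Q b = {}" unfolding P_def Q_def using ab by auto
  qed (use k2 ks in \<open>auto intro: adj'\<close>)
  moreover have "Suc (card {1..k - 1}) = nat k" using k2 by simp
  ultimately show ?thesis by simp
qed

text \<open>For \<open>d \<ge> k - 1\<close>, moving the origin to \<open>R d\<close> replaces the
  distance by \<open>s - d\<close>, to which \<open>linked_RR_far\<close> applies.\<close>

lemma linked_RR_0:
  assumes "0 < d" "d < s"
  shows "linked F (nat k) (R 0) (R d)"
proof -
  consider "d + k - 1 \<le> s" | "d < k - 1" "s < d + k - 1" | "k - 1 \<le> d" by linarith
  then show ?thesis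
  proof cases
    case 3
    interpret S: circulant "\<lambda>x. L (x + d)" "\<lambda>x. R (x + d)" F s k by (rule shift)
    have "linked F (nat k) (R (0 + d)) (R (s - d + d))" using 3 assms by (intro S.linked_RR_far) auto
    then show ?thesis using perR[of 0] linked_sym by simp
  qed (use assms linked_RR_far linked_RR_dense in auto)
qed

lemma linked_RL_from_0:
  assumes "0 \<le> e" "e < s"
  shows "linked F (nat k) (R 0) (L e)"
proof -
  consider "k \<le> e" | "0 < e" "e < k - 1" | "e = 0" | "e = k - 1" using assms by linarith
  then show ?thesis
  proof cases
    case 4
    interpret S: circulant "\<lambda>x. L (k - 1 - x)" "\<lambda>x. R (- x)" F s k by (rule reflect)
    show ?thesis using S.linked_RL_0 4 by simp
  qed (use assms linked_RL_far linked_RL_middle linked_RL_0 in auto)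
qed

lemma per_mult: "L (i + n * s) = L i \<and> R (i + n * s) = R i"
proof (induction n rule: int_induct[of _ 0])
  case (step1 n)
  then show ?case using perL[of "i + n * s"] perR[of "i + n * s"] by (simp add: algebra_simps)
next
  case (step2 n)
  then show ?case using perL[of "i + (n - 1) * s"] perR[of "i + (n - 1) * s"] by (simp add: algebra_simps)
qed simp

lemma per_mod: "L (i mod s) = L i" "R (i mod s) = R i"
  using per_mult[of "i mod s" "i div s"] by (simp_all add: mod_div_mult_eq)

lemma linked_RL: "linked F (nat k) (R x) (L y)"
proof -
  interpret S: circulant "\<lambda>z. L (z + x)" "\<lambda>z. R (z + x)" F s k by (rule shift)
  have "linked F (nat k) (R (0 + x)) (L ((y - x) mod s + x))"
    using k2 ks by (intro S.linked_RL_from_0) auto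
  moreover have "L ((y - x) mod s + x) = L y" using S.per_mod(1)[of "y - x"] by simp
  ultimately show ?thesis by simp
qed

lemma linked_RR:
  assumes "R x \<noteq> R y"
  shows "linked F (nat k) (R x) (R y)"
proof -
  interpret S: circulant "\<lambda>z. L (z + x)" "\<lambda>z. R (z + x)" F s k by (rule shift)
  have eq: "R ((y - x) mod s + x) = R y" using S.per_mod(2)[of "y - x"] by simp
  then have "(y - x) mod s \<noteq> 0" using assms by auto
  moreover have "0 \<le> (y - x) mod s" "(y - x) mod s < s" using k2 ks by auto
  ultimately have "linked F (nat k) (R (0 + x)) (R ((y - x) mod s + x))"
    by (intro S.linked_RR_0) auto
  then show ?thesis using eq by simp
qed

lemma linked_LL:
  assumes "L x \<noteq> L y"
  shows "linked F (nat k) (L x) (L y)"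
proof -
  interpret S: circulant "\<lambda>x. R (- x)" "\<lambda>x. L (- x)" F s k by (rule swap)
  show ?thesis using S.linked_RR[of "- x" "- y"] assms by simp
qed

end

text \<open>Right vertices that are congruent modulo \<open>s\<close> are twins.\<close>

definition circ_edges :: "nat \<Rightarrow> nat \<Rightarrow> nat \<Rightarrow> (nat + nat) set set" where
  "circ_edges s t k = {{Inl ((j + a) mod s), Inr j} | j a. j < t \<and> a < k}"

lemma circ_edgesI: "j < t \<Longrightarrow> a < k \<Longrightarrow> {Inl ((j + a) mod s), Inr j} \<in> circ_edges s t k"
  unfolding circ_edges_def by blast

text \<open>Any choice \<open>\<rho>\<close> of one right vertex per residue class spans a circulant
  together with the left side; to link given right vertices of different classes,
  \<open>\<rho>\<close> is chosen to pass through them.\<close>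

lemma circulant_section:
  assumes "2 \<le> k" "k \<le> s" "\<And>r. r < s \<Longrightarrow> \<rho> r mod s = r \<and> \<rho> r < t"
  shows "circulant (\<lambda>x. Inl (nat (x mod int s))) (\<lambda>x. Inr (\<rho> (nat (x mod int s))))
    (circ_edges s t k) (int s) (int k)"
proof
  have s: "0 < s" using assms by simp
  have lt: "nat (i mod int s) < s" for i
    using s by (metis nat_less_iff of_nat_0_less_iff pos_mod_bound pos_mod_sign)
  have inj: "i = j" if "nat (i mod int s) = nat (j mod int s)" "\<bar>i - j\<bar> < int s" for i j
  proof -
    have "i mod int s = j mod int s" using that(1) s by (simp add: eq_nat_nat_iff)
    then have "int s dvd i - j" by (simp add: mod_eq_dvd_iff)
    then show ?thesis using that(2) dvd_imp_le_int[of "i - j" "int s"] by fastforce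
  qed
  show "i = j" if "(Inl (nat (i mod int s)) :: nat + nat) = Inl (nat (j mod int s))" "\<bar>i - j\<bar> < int s" for i j
    using inj that by simp
  show "i = j" if "(Inr (\<rho> (nat (i mod int s))) :: nat + nat) = Inr (\<rho> (nat (j mod int s)))"
    "\<bar>i - j\<bar> < int s" for i j
  proof (rule inj[OF _ that(2)])
    show "nat (i mod int s) = nat (j mod int s)"
      using that(1) assms(3)[OF lt[of i]] assms(3)[OF lt[of j]] by (metis sum.inject(2))
  qed
  show "{Inl (nat (i mod int s)), Inr (\<rho> (nat (j mod int s)))} \<in> circ_edges s t k"
    if ij: "j \<le> i" "i \<le> j + int k - 1" for i j
  proof -
    define r a where "r = \<rho> (nat (j mod int s))" and "a = nat (i - j)"
    have r: "r mod s = nat (j mod int s)" "r < t" using assms(3)[OF lt[of j]] r_def by auto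
    have a: "a < k" "int a = i - j" using ij a_def by auto
    have "int (r mod s) = j mod int s" using r(1) s by simp
    then have "int ((r + a) mod s) = (j + (i - j)) mod int s"
      using a(2) by (metis mod_add_left_eq of_nat_add zmod_int)
    then have "(r + a) mod s = nat (i mod int s)" by simp
    then show ?thesis using circ_edgesI[OF r(2) a(1), of s] r_def by simp
  qed
qed (use assms in auto)

lemma circ_edges_linked:
  assumes "2 \<le> k" "k \<le> s" "s \<le> t" "u \<in> Kbip_V s t" "v \<in> Kbip_V s t" "u \<noteq> v"
  shows "linked (circ_edges s t k) k u v"
proof -
  have s: "0 < s" using assms by simp
  have RL: "linked (circ_edges s t k) k (Inr j) (Inl i)" if "i < s" "j < t" for i j
  proof -
    \<comment> \<open>The residues themselves are the default representatives, valid as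
      \<open>s \<le> t\<close>; only the class of \<open>j\<close> is changed.\<close>
    define \<rho> where "\<rho> = id (j mod s := j)"
    interpret circulant "\<lambda>x. Inl (nat (x mod int s))" "\<lambda>x. Inr (\<rho> (nat (x mod int s)))"
      "circ_edges s t k" "int s" "int k"
      by (rule circulant_section) (use assms that in \<open>auto simp: \<rho>_def\<close>)
    have "\<rho> (nat (int j mod int s)) = j" unfolding \<rho>_def by (simp flip: zmod_int)
    then show ?thesis using linked_RL[of "int j" "int i"] that by (simp flip: zmod_int)
  qed
  have RR: "linked (circ_edges s t k) k (Inr j) (Inr j')" if j: "j < t" "j' < t" "j \<noteq> j'" for j j'
  proof (cases "j mod s = j' mod s")
    case False
    define \<rho> where "\<rho> = id (j mod s := j, j' mod s := j')"
    interpret circulant "\<lambda>x. Inl (nat (x mod int s))" "\<lambda>x. Inr (\<rho> (nat (x mod int s)))"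
      "circ_edges s t k" "int s" "int k"
      by (rule circulant_section) (use assms that in \<open>auto simp: \<rho>_def\<close>)
    have "\<rho> (nat (int j mod int s)) = j" "\<rho> (nat (int j' mod int s)) = j'"
      unfolding \<rho>_def using False by (simp_all flip: zmod_int)
    then show ?thesis using linked_RR[of "int j" "int j'"] j by simp
  next
    case True
    \<comment> \<open>Twins lie on no common section, but they share \<open>k\<close> distinct
      neighbours.\<close>
    let ?X = "\<lambda>a. {Inl ((j + a) mod s)} :: (nat + nat) set"
    have "linked (circ_edges s t k) (card {..<k}) (Inr j) (Inr j')"
    proof (rule linked_through_sets(1)[of _ _ _ ?X])
      show "?X a \<inter> ?X b = {}" if "a \<in> {..<k}" "b \<in> {..<k}" "a \<noteq> b" for a b
      proof -
        have "(j + a) mod s \<noteq> (j + b) mod s"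
        proof
          assume "(j + a) mod s = (j + b) mod s"
          then have "(int j + int a) mod int s = (int j + int b) mod int s"
            by (metis of_nat_add zmod_int)
          then have "int s dvd int a - int b" by (simp add: mod_eq_dvd_iff)
          then have "int s \<le> \<bar>int a - int b\<bar>" using dvd_imp_le_int[of "int a - int b" "int s"] that by simp
          then show False using that assms by auto
        qed
        then show ?thesis by simp
      qed
      show "\<exists>x\<in>?X a. \<exists>y. {Inr j, x} \<in> circ_edges s t k \<and> {y, Inr j'} \<in> circ_edges s t k \<and>
          reach (circ_edges s t k) (?X a) x y" if "a \<in> {..<k}" for a
      proof -
        have "(j + a) mod s = (j' + a) mod s" using True by (metis mod_add_left_eq)
        then have "{Inl ((j + a) mod s), Inr j} \<in> circ_edges s t k"
          "{Inl ((j + a) mod s), Inr j'} \<in> circ_edges s t k"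
          using circ_edgesI[of j t a k s] circ_edgesI[of j' t a k s] that j by simp_all
        then show ?thesis
          by (intro bexI[of _ "Inl ((j + a) mod s)"] exI[of _ "Inl ((j + a) mod s)"])
            (auto simp: insert_commute reach_refl)
      qed
    qed (use j in auto)
    then show ?thesis by simp
  qed
  have LL: "linked (circ_edges s t k) k (Inl i) (Inl i')" if i: "i < s" "i' < s" "i \<noteq> i'" for i i'
  proof -
    interpret circulant "\<lambda>x. Inl (nat (x mod int s))" "\<lambda>x. Inr (id (nat (x mod int s)))"
      "circ_edges s t k" "int s" "int k"
      by (rule circulant_section) (use assms in auto)
    show ?thesis using linked_LL[of "int i" "int i'"] i by (simp flip: zmod_int)
  qed
  show ?thesis using assms(4-6) unfolding Kbip_V_def by (auto intro: RL RR LL linked_sym[OF RL])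
qed

section \<open>The colouring for the lower bound\<close>

lemma card_Kbip_E: "card (Kbip_E s t) = s * t"
proof -
  have "Kbip_E s t = (\<lambda>(i, j). {Inl i, Inr j}) ` ({..<s} \<times> {..<t})" unfolding Kbip_E_def by auto
  moreover have "inj_on (\<lambda>(i, j). {Inl i, Inr j} :: (nat + nat) set) ({..<s} \<times> {..<t})"
    by (auto simp: inj_on_def doubleton_eq_iff)
  ultimately show ?thesis by (simp add: card_image card_cartesian_product)
qed

lemma exists_colouring:
  assumes "2 \<le> k" "k \<le> s" "s \<le> t"
  shows "\<exists>c :: (nat + nat) set \<Rightarrow> nat. mono_k_connected (Kbip_V s t) (Kbip_E s t) k c \<and>
    int (s * t) - int (k * t) + 1 \<le> int (card (c ` Kbip_E s t))"
proof -
  define F where "F = circ_edges s t k"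
  have s: "0 < s" using assms by simp
  have FE: "F \<subseteq> Kbip_E s t" unfolding F_def circ_edges_def Kbip_E_def using s by fastforce
  have "F = (\<lambda>(j, a). {Inl ((j + a) mod s), Inr j}) ` ({..<t} \<times> {..<k})"
    unfolding F_def circ_edges_def by auto
  \<comment> \<open>An upper bound suffices: fewer edges in \<open>F\<close> leave more edges with a
    colour of their own.\<close>
  then have cF: "card F \<le> k * t"
    using card_image_le[of "{..<t} \<times> {..<k}" "\<lambda>(j, a). {Inl ((j + a) mod s), Inr j}"]
    by (simp add: card_cartesian_product mult.commute)
  \<comment> \<open>An edge in \<open>F\<close> makes colour 0 occur; this is the \<open>+ 1\<close>
    in the bound.\<close>
  obtain f where f: "f \<in> F" using circ_edgesI[of 0 t 0 k s] assms unfolding F_def by force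
  obtain h :: "(nat + nat) set \<Rightarrow> nat" where h: "inj_on h (Kbip_E s t - F)"
    using finite_imp_inj_to_nat_seg[of "Kbip_E s t - F"] finite_Kbip_E by blast
  \<comment> \<open>\<open>Suc\<close> keeps colour 0 reserved for \<open>F\<close>.\<close>
  define c where "c e = (if e \<in> F then 0 else Suc (h e))" for e
  have "mono_k_connected (Kbip_V s t) (Kbip_E s t) k c"
    unfolding mono_k_connected_def
  proof (intro ballI impI)
    fix u v assume "u \<in> Kbip_V s t" "v \<in> Kbip_V s t" "u \<noteq> v"
    then obtain Ps where Ps: "linkage {F} k u v Ps"
      using circ_edges_linked[OF assms] unfolding linked_def F_def by blast
    have "is_path (Kbip_E s t) P u v \<and> monochromatic c P" if "P \<in> set Ps" for P
    proof -
      have P: "is_path F P u v" using Ps that unfolding linkage_def by blast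
      then have "\<forall>i. Suc i < length P \<longrightarrow> c {P ! i, P ! Suc i} = 0"
        unfolding is_path_def c_def by simp
      then show ?thesis using P FE unfolding is_path_def monochromatic_def by blast
    qed
    then show "\<exists>Ps. length Ps = k \<and> distinct Ps \<and>
        (\<forall>P\<in>set Ps. is_path (Kbip_E s t) P u v \<and> monochromatic c P) \<and>
        (\<forall>i<k. \<forall>j<k. i \<noteq> j \<longrightarrow> interior (Ps ! i) \<inter> interior (Ps ! j) = {})"
      using Ps unfolding linkage_def by blast
  qed
  moreover have "int (s * t) - int (k * t) + 1 \<le> int (card (c ` Kbip_E s t))"
  proof -
    have "insert 0 (Suc ` h ` (Kbip_E s t - F)) \<subseteq> c ` Kbip_E s t"
      unfolding c_def using f FE by force
    then have "card (insert 0 (Suc ` h ` (Kbip_E s t - F))) \<le> card (c ` Kbip_E s t)"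
      using finite_Kbip_E by (intro card_mono) auto
    moreover have "card (insert 0 (Suc ` h ` (Kbip_E s t - F))) = Suc (card (Kbip_E s t - F))"
      using finite_Kbip_E[of s t] h by (subst card_insert_disjoint) (auto simp: card_image)
    moreover have "card (Kbip_E s t - F) = s * t - card F"
      using card_Diff_subset[OF finite_subset[OF FE finite_Kbip_E] FE] card_Kbip_E by simp
    ultimately show ?thesis using cF by linarith
  qed
  ultimately show ?thesis by blast
qed

theorem theorem4p4:
  shows "(\<forall>s t k::nat. 2 \<le> k \<and> k \<le> s \<and> s \<le> t \<longrightarrow>
            int (s * t) - int (k * t) + 1 \<le> int (mcK s t k) \<and>
            int (mcK s t k) \<le> int (s * t) - \<lceil>real (k * t) / 2\<rceil> + 1 \<and>
            ((s = k \<or> k \<in> {2, 3}) \<longrightarrow> int (mcK s t k) = int (s * t) - int (k * t) + 1))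
       \<and> (\<forall>t k::nat. 2 \<le> k \<and> k \<le> t \<longrightarrow>
            int (t * t) - int (k * t) + 1 \<le> int (mcK t t k) \<and>
            int (mcK t t k) \<le> int (t * t) - \<lceil>(real k - 1 / 2) * real t\<rceil> + 1 \<and>
            (k \<in> {2, 3, 4, 5} \<longrightarrow> int (mcK t t k) = int (t * t) - int (k * t) + 1))"
proof -
  have lower: "int (s * t) - int (k * t) + 1 \<le> int (mcK s t k)"
    and ex: "\<exists>c :: (nat + nat) set \<Rightarrow> nat. mono_k_connected (Kbip_V s t) (Kbip_E s t) k c"
    if kst: "2 \<le> k" "k \<le> s" "s \<le> t" for s t k
  proof -
    obtain c :: "(nat + nat) set \<Rightarrow> nat" where c: "mono_k_connected (Kbip_V s t) (Kbip_E s t) k c"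
      "int (s * t) - int (k * t) + 1 \<le> int (card (c ` Kbip_E s t))"
      using exists_colouring[OF kst] by blast
    show "int (s * t) - int (k * t) + 1 \<le> int (mcK s t k)" using c(2) mcK_ge[OF c(1)] by linarith
    show "\<exists>c :: (nat + nat) set \<Rightarrow> nat. mono_k_connected (Kbip_V s t) (Kbip_E s t) k c" using c(1) by blast
  qed
  have half: "int (mcK s t k) \<le> int (s * t) - \<lceil>real (k * t) / 2\<rceil> + 1"
    if kst: "2 \<le> k" "k \<le> s" "s \<le> t" for s t k
    using mcK_le_half[OF kst ex[OF kst]] by linarith
  have exact: "int (mcK s t k) = int (s * t) - int (k * t) + 1"
    if kst: "2 \<le> k" "k \<le> s" "s \<le> t" and c: "s = k \<or> k \<le> 3 \<or> s = t \<and> k \<le> 5" for s t k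
    using mcK_le_exact[OF kst ex[OF kst] c] lower[OF kst] by linarith
  show ?thesis
    using lower half exact mcK_le_balanced[OF _ _ ex] by auto
qed

end
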